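(* Let $\mathbb{F}$ be an algebraically closed field of characteristic $p>2$, let $\lambda\in\mathbb{F}^p$, and let $L_{p,p}^{\lambda}$ be the restricted model filiform Lie superalgebra. Then $\dim H^2(L_{p,p}^{\lambda},\mathbb{F})=2p+1$ (ordinary cohomology, $\mathbb F$ the $1$-dimensional trivial module), and the cohomology classes of the cocycles $$\Omega^4=\{X^{1,p},\ X^1Y^p,\ \varphi_5,\varphi_7,\ldots,\varphi_{p+2},\ \psi_2,\ldots,\psi_p,\ \phi_2,\phi_4,\ldots,\phi_{p+1}\}$$ form a basis, where for $i\in\{5,7,\ldots,p+2\}$, $2\le j\le p$ and $k\in\{2,4,\ldots,p+1\}$ $$\varphi_i=\sum_{r=2}^{\lfloor i/2\rfloor}(-1)^rX^{r,i-r},\quad \psi_j=\sum_{s=2}^{j}(-1)^sX^sY^{j-s+1},\quad \phi_k=\sum_{t=1}^{\frac k2-1}(-1)^tY^{t,k-t}+(-1)^{\frac k2}\tfrac12Y^{\frac k2,\frac k2}.$$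
   Context: $L_{p,p}^\lambda$, for $\lambda=(\lambda_1,\ldots,\lambda_p)\in\mathbb F^p$, is the Lie superalgebra with even basis $X_1,\ldots,X_p$, odd basis $Y_1,\ldots,Y_p$, super-brackets $[X_1,X_i]=X_{i+1}$ ($2\le i\le p-1$), $[X_1,Y_j]=Y_{j+1}$ ($1\le j\le p-1$), all other brackets of basis elements (not determined by super-skew-symmetry) being zero, and with $p$-map on the even part $(\sum_{k=1}^pa_kX_k)^{[p]}=(\sum_{k=1}^pa_k^p\lambda_k)X_p$; it is a restricted Lie superalgebra. Ordinary cohomology with trivial coefficients, $L=L_{p,p}^\lambda$, $|x|$ the parity of $x$: $C^q(L;\mathbb F)=\mathrm{Hom}_{\mathbb F}(\bigwedge^qL,\mathbb F)$, where $\bigwedge^qL$ is the super-exterior power, i.e. $L^{\otimes q}$ modulo the span of the elements $\cdots\otimes x_k\otimes x_{k+1}\otimes\cdots+(-1)^{|x_k||x_{k+1}|}\cdots\otimes x_{k+1}\otimes x_k\otimes\cdots$. For $\varphi\in C^1(L;\mathbb F)$, $d^1\varphi(x,y)=-\varphi([x,y])$; for $\alpha\in C^2(L;\mathbb F)$, $$d^2\alpha(x_1,x_2,x_3)=-\alpha([x_1,x_2],x_3)+(-1)^{|x_2||x_3|}\alpha([x_1,x_3],x_2)-(-1)^{|x_1|(|x_2|+|x_3|)}\alpha([x_2,x_3],x_1).$$ $H^2(L,\mathbb F)=\mathrm{Ker}\,d^2/\mathrm{Im}\,d^1$. Basis of $C^2(L;\mathbb F)$: $X^{i,j}$ ($1\le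 i<j\le p$), $X^kY^l$ ($1\le k,l\le p$), $Y^{s,t}$ ($1\le s\le t\le p$), where $X^{i,j}(X_i,X_j)=1=-X^{i,j}(X_j,X_i)$; $X^kY^l(X_k,Y_l)=1=-X^kY^l(Y_l,X_k)$; $Y^{s,t}(Y_s,Y_t)=Y^{s,t}(Y_t,Y_s)=1$ for $s<t$ and $Y^{s,s}(Y_s,Y_s)=2$; each vanishes on all other pairs of basis vectors. *)

theory Defs
  imports "Jordan_Normal_Form.VS_Connect" "HOL-Algebra.AbelCoset"
begin

section \<open>Restricted Lie superalgebras and their low-degree cohomology\<close>

text \<open>Scalars live in a type of class \<^class>\<open>field\<close>; \<^term>\<open>class_ring\<close> is that field as a
  \<^verbatim>\<open>HOL-Algebra\<close> record. The multiplicative record fields \<^const>\<open>mult\<close> and \<^const>\<open>one\<close> of a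
  module are irrelevant and left undefined.\<close>

record ('a, 'v) lie_superalgebra = "('a, 'v) module" +
  even_part :: "'v set"
  odd_part :: "'v set"
  bracket :: "'v \<Rightarrow> 'v \<Rightarrow> 'v"

text \<open>Only the values of \<^term>\<open>p_map\<close> on the even part are meaningful.\<close>

record ('a, 'v) restricted_lie_superalgebra = "('a, 'v) lie_superalgebra" +
  p_map :: "'v \<Rightarrow> 'v"

text \<open>Parities are natural numbers read modulo 2. The zero vector is homogeneous of both parities,
  so parities are quantified separately instead of being computed from the vector.\<close>

definition hom_part :: "('a, 'v, 'm) lie_superalgebra_scheme \<Rightarrow> nat \<Rightarrow> 'v set" where
  "hom_part L a = (if even a then even_part L else odd_part L)"

definition hom_comp :: "('a, 'v, 'm) lie_superalgebra_scheme \<Rightarrow> nat \<Rightarrow> 'v \<Rightarrow> 'v" where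
  "hom_comp L a x =
     (THE y. y \<in> hom_part L a \<and> (\<exists>z \<in> hom_part L (Suc a). x = y \<oplus>\<^bsub>L\<^esub> z))"

text \<open>A linear form on the \<open>q\<close>-th super-exterior power, that is on the \<open>q\<close>-fold tensor power modulo
  \<open>\<dots> \<otimes> x \<otimes> y \<otimes> \<dots> + (-1)\<^sup>|\<^sup>x\<^sup>|\<^sup>|\<^sup>y\<^sup>| \<dots> \<otimes> y \<otimes> x \<otimes> \<dots>\<close>, is the same thing as a \<open>q\<close>-linear form that
  vanishes on these elements. It is encoded as a function of the list of its \<open>q\<close> arguments, with
  value 0 on lists that are not \<open>q\<close>-tuples of vectors of \<open>L\<close>, so that equality of cochains is
  equality of functions.\<close>

definition cochains ::
  "('a::field, 'v, 'm) lie_superalgebra_scheme \<Rightarrow> nat \<Rightarrow> ('v list \<Rightarrow> 'a) set" where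
  "cochains L q = {f.
     (\<forall>xs. \<not> (length xs = q \<and> set xs \<subseteq> carrier L) \<longrightarrow> f xs = 0) \<and>
     (\<forall>us x y vs. length us + length vs + 1 = q \<and> set us \<union> {x, y} \<union> set vs \<subseteq> carrier L \<longrightarrow>
        f (us @ (x \<oplus>\<^bsub>L\<^esub> y) # vs) = f (us @ x # vs) + f (us @ y # vs)) \<and>
     (\<forall>us c x vs. length us + length vs + 1 = q \<and> set us \<union> {x} \<union> set vs \<subseteq> carrier L \<longrightarrow>
        f (us @ (c \<odot>\<^bsub>L\<^esub> x) # vs) = c * f (us @ x # vs)) \<and>
     (\<forall>us x y vs a b. length us + length vs + 2 = q \<and> set us \<union> set vs \<subseteq> carrier L \<and>
        x \<in> hom_part L a \<and> y \<in> hom_part L b \<longrightarrow>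
        f (us @ x # y # vs) + (-1) ^ (a * b) * f (us @ y # x # vs) = 0)}"

definition cochain_d1 ::
  "('a::field, 'v, 'm) lie_superalgebra_scheme \<Rightarrow> ('v list \<Rightarrow> 'a) \<Rightarrow> 'v list \<Rightarrow> 'a" where
  "cochain_d1 L \<phi> xs =
     (if length xs = 2 \<and> set xs \<subseteq> carrier L then - \<phi> [bracket L (xs ! 0) (xs ! 1)] else 0)"

text \<open>The formula for \<open>d\<^sup>2\<close> on homogeneous vectors \<open>x, y, z\<close> of parities \<open>a, b, c\<close>; \<^term>\<open>cochain_d2\<close>
  is its trilinear extension.\<close>

definition d2_homogeneous ::
  "('a::field, 'v, 'm) lie_superalgebra_scheme \<Rightarrow> ('v list \<Rightarrow> 'a) \<Rightarrow>
     nat \<Rightarrow> nat \<Rightarrow> nat \<Rightarrow> 'v \<Rightarrow> 'v \<Rightarrow> 'v \<Rightarrow> 'a" where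
  "d2_homogeneous L \<alpha> a b c x y z =
     - \<alpha> [bracket L x y, z]
     + (-1) ^ (b * c) * \<alpha> [bracket L x z, y]
     - (-1) ^ (a * (b + c)) * \<alpha> [bracket L y z, x]"

definition cochain_d2 ::
  "('a::field, 'v, 'm) lie_superalgebra_scheme \<Rightarrow> ('v list \<Rightarrow> 'a) \<Rightarrow> 'v list \<Rightarrow> 'a" where
  "cochain_d2 L \<alpha> xs =
     (if length xs = 3 \<and> set xs \<subseteq> carrier L then
        (\<Sum>a<2. \<Sum>b<2. \<Sum>c<2. d2_homogeneous L \<alpha> a b c
           (hom_comp L a (xs ! 0)) (hom_comp L b (xs ! 1)) (hom_comp L c (xs ! 2)))
      else 0)"

definition cocycles2 :: "('a::field, 'v, 'm) lie_superalgebra_scheme \<Rightarrow> ('v list \<Rightarrow> 'a) set" where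
  "cocycles2 L = {\<alpha> \<in> cochains L 2. cochain_d2 L \<alpha> = (\<lambda>_. 0)}"

definition coboundaries2 :: "('a::field, 'v, 'm) lie_superalgebra_scheme \<Rightarrow> ('v list \<Rightarrow> 'a) set" where
  "coboundaries2 L = cochain_d1 L ` cochains L 1"

definition cocycle_space ::
  "('a::field, 'v, 'm) lie_superalgebra_scheme \<Rightarrow> ('a, 'v list \<Rightarrow> 'a) module" where
  "cocycle_space L = \<lparr>carrier = cocycles2 L, mult = undefined, one = undefined,
     zero = (\<lambda>_. 0), add = (\<lambda>f g xs. f xs + g xs), smult = (\<lambda>c f xs. c * f xs)\<rparr>"

text \<open>The quotient of a module by a submodule, on the additive cosets of \<^verbatim>\<open>HOL-Algebra\<close>. In the
  scalar multiplication the union over representatives is a union of equal cosets.\<close>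

definition quotient_module :: "('a, 'v, 'm) module_scheme \<Rightarrow> 'v set \<Rightarrow> ('a, 'v set) module" where
  "quotient_module M N = \<lparr>carrier = a_rcosets\<^bsub>M\<^esub> N, mult = undefined, one = undefined,
     zero = N, add = set_add M, smult = (\<lambda>c A. \<Union>v\<in>A. N +>\<^bsub>M\<^esub> (c \<odot>\<^bsub>M\<^esub> v))\<rparr>"

definition H2 ::
  "('a::field, 'v, 'm) lie_superalgebra_scheme \<Rightarrow> ('a, ('v list \<Rightarrow> 'a) set) module" where
  "H2 L = quotient_module (cocycle_space L) (coboundaries2 L)"

definition cohomology_class ::
  "('a::field, 'v, 'm) lie_superalgebra_scheme \<Rightarrow> ('v list \<Rightarrow> 'a) \<Rightarrow> ('v list \<Rightarrow> 'a) set" where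
  "cohomology_class L \<alpha> = coboundaries2 L +>\<^bsub>cocycle_space L\<^esub> \<alpha>"

section \<open>The model filiform Lie superalgebra\<close>

text \<open>A vector is its coordinate function with respect to the basis \<open>X 1, \<dots>, X p, Y 1, \<dots>, Y p\<close>,
  and vanishes outside these labels.\<close>

datatype gen = X nat | Y nat

definition gens :: "nat \<Rightarrow> gen set" where
  "gens p = X ` {1..p} \<union> Y ` {1..p}"

definition basis_vec :: "gen \<Rightarrow> gen \<Rightarrow> 'a::field" where
  "basis_vec g = (\<lambda>h. if h = g then 1 else 0)"

fun basis_bracket :: "nat \<Rightarrow> gen \<Rightarrow> gen \<Rightarrow> gen \<Rightarrow> 'a::field" where
  "basis_bracket p (X i) (X j) =
     (if i = 1 \<and> 2 \<le> j \<and> j \<le> p - 1 then basis_vec (X (j + 1))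
      else if j = 1 \<and> 2 \<le> i \<and> i \<le> p - 1 then (\<lambda>h. - basis_vec (X (i + 1)) h)
      else (\<lambda>_. 0))"
| "basis_bracket p (X i) (Y j) =
     (if i = 1 \<and> 1 \<le> j \<and> j \<le> p - 1 then basis_vec (Y (j + 1)) else (\<lambda>_. 0))"
| "basis_bracket p (Y j) (X i) =
     (if i = 1 \<and> 1 \<le> j \<and> j \<le> p - 1 then (\<lambda>h. - basis_vec (Y (j + 1)) h) else (\<lambda>_. 0))"
| "basis_bracket p (Y i) (Y j) = (\<lambda>_. 0)"

text \<open>Of the function \<open>lam\<close> only the coordinates \<open>lam 1, \<dots>, lam p\<close> are used.\<close>

definition model_filiform ::
  "nat \<Rightarrow> (nat \<Rightarrow> 'a::field) \<Rightarrow> ('a, gen \<Rightarrow> 'a) restricted_lie_superalgebra" where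
  "model_filiform p lam = \<lparr>
     carrier = {v. \<forall>g. g \<notin> gens p \<longrightarrow> v g = 0},
     mult = undefined, one = undefined,
     zero = (\<lambda>_. 0), add = (\<lambda>u v g. u g + v g), smult = (\<lambda>c v g. c * v g),
     even_part = {v. \<forall>g. g \<notin> X ` {1..p} \<longrightarrow> v g = 0},
     odd_part = {v. \<forall>g. g \<notin> Y ` {1..p} \<longrightarrow> v g = 0},
     bracket = (\<lambda>u v h. \<Sum>a\<in>gens p. \<Sum>b\<in>gens p. u a * v b * basis_bracket p a b h),
     p_map = (\<lambda>v h. (\<Sum>k=1..p. v (X k) ^ p * lam k) * basis_vec (X p) h)\<rparr>"

section \<open>Basis cochains and the distinguished cocycles\<close>

definition bilinear_cochain ::
  "nat \<Rightarrow> (gen \<Rightarrow> gen \<Rightarrow> 'a::field) \<Rightarrow> (gen \<Rightarrow> 'a) list \<Rightarrow> 'a" where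
  "bilinear_cochain p m xs =
     (if length xs = 2 \<and> (\<forall>v \<in> set xs. \<forall>g. g \<notin> gens p \<longrightarrow> v g = 0) then
        (\<Sum>a\<in>gens p. \<Sum>b\<in>gens p. (xs ! 0) a * (xs ! 1) b * m a b)
      else 0)"

definition XX :: "nat \<Rightarrow> nat \<Rightarrow> nat \<Rightarrow> (gen \<Rightarrow> 'a::field) list \<Rightarrow> 'a" where
  "XX p i j = bilinear_cochain p (\<lambda>a b.
     if a = X i \<and> b = X j then 1 else if a = X j \<and> b = X i then -1 else 0)"

definition XY :: "nat \<Rightarrow> nat \<Rightarrow> nat \<Rightarrow> (gen \<Rightarrow> 'a::field) list \<Rightarrow> 'a" where
  "XY p k l = bilinear_cochain p (\<lambda>a b.
     if a = X k \<and> b = Y l then 1 else if a = Y l \<and> b = X k then -1 else 0)"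

definition YY :: "nat \<Rightarrow> nat \<Rightarrow> nat \<Rightarrow> (gen \<Rightarrow> 'a::field) list \<Rightarrow> 'a" where
  "YY p s t = bilinear_cochain p (\<lambda>a b.
     if (a = Y s \<and> b = Y t) \<or> (a = Y t \<and> b = Y s) then (if s = t then 2 else 1) else 0)"

definition phi_XX :: "nat \<Rightarrow> nat \<Rightarrow> (gen \<Rightarrow> 'a::field) list \<Rightarrow> 'a" where
  "phi_XX p i = (\<lambda>xs. \<Sum>r=2..i div 2. (-1) ^ r * XX p r (i - r) xs)"

definition psi_XY :: "nat \<Rightarrow> nat \<Rightarrow> (gen \<Rightarrow> 'a::field) list \<Rightarrow> 'a" where
  "psi_XY p j = (\<lambda>xs. \<Sum>s=2..j. (-1) ^ s * XY p s (j + 1 - s) xs)"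

definition phi_YY :: "nat \<Rightarrow> nat \<Rightarrow> (gen \<Rightarrow> 'a::field) list \<Rightarrow> 'a" where
  "phi_YY p k = (\<lambda>xs. (\<Sum>t=1..k div 2 - 1. (-1) ^ t * YY p t (k - t) xs)
     + (-1) ^ (k div 2) * (1 / 2) * YY p (k div 2) (k div 2) xs)"

definition Omega4 :: "nat \<Rightarrow> ((gen \<Rightarrow> 'a::field) list \<Rightarrow> 'a) set" where
  "Omega4 p = {XX p 1 p, XY p 1 p}
     \<union> phi_XX p ` {i. odd i \<and> 5 \<le> i \<and> i \<le> p + 2}
     \<union> psi_XY p ` {2..p}
     \<union> phi_YY p ` {k. even k \<and> 2 \<le> k \<and> k \<le> p + 1}"

end

theory Submission
  imports Defs
begin

text \<open>A 2-cochain is determined by its supersymmetric matrix \<open>m\<close> on the basis. Since \<open>ad X\<^sub>1\<close> is the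
  only nonzero adjoint action of a basis vector up to sign, \<open>d\<^sup>2\<close> vanishes iff
  \<open>m (ad X\<^sub>1 b) c + m b (ad X\<^sub>1 c) = 0\<close> for all basis vectors \<open>b, c \<noteq> X\<^sub>1\<close>. On each of the blocks
  \<open>X\<^sub>i X\<^sub>j\<close>, \<open>X\<^sub>i Y\<^sub>j\<close>, \<open>Y\<^sub>i Y\<^sub>j\<close> this is the recurrence \<open>f (i + 1) j = - f i (j + 1)\<close>, read with value 0
  beyond index \<open>p\<close>, so that a block is determined by its first row; the symmetry of the block and the cut-off
  at \<open>p\<close> leave free exactly the entries \<open>(X\<^sub>2, X\<^sub>j)\<close> with \<open>j \<ge> 3\<close> odd, \<open>(X\<^sub>2, Y\<^sub>j)\<close> with \<open>j < p\<close> and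
  \<open>(Y\<^sub>1, Y\<^sub>j)\<close> with \<open>j\<close> odd. Coboundaries only involve the entries \<open>(X\<^sub>1, X\<^sub>j)\<close> and \<open>(X\<^sub>1, Y\<^sub>j)\<close>, all of which
  occur except \<open>(X\<^sub>1, X\<^sub>p)\<close> and \<open>(X\<^sub>1, Y\<^sub>p)\<close>. Up to sign, reading off these \<open>2p + 1\<close> entries gives linear forms on
  the cocycles that are dual to the distinguished ones and have the coboundaries as common kernel.\<close>

section \<open>Bases of quotient spaces from dual families of linear forms\<close>

text \<open>Applying \<open>l i\<close> to a linear combination of the \<open>q j\<close> returns
  the coefficient at \<open>q i\<close>, which gives independence. For spanning, \<open>x\<close>
  minus the combination with coefficients \<open>l i x\<close> is killed by every \<open>l i\<close>
  and is therefore zero.\<close>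

lemma vectorspace_basis_of_dual_family:
  fixes V :: "('a::field, 'v, 'm) module_scheme" and q :: "'i \<Rightarrow> 'v" and l :: "'i \<Rightarrow> 'v \<Rightarrow> 'a"
  assumes V: "vectorspace class_ring V" and finite_I: "finite I"
    and q: "q ` I \<subseteq> carrier V"
    and l_add: "\<And>i x y. i \<in> I \<Longrightarrow> x \<in> carrier V \<Longrightarrow> y \<in> carrier V \<Longrightarrow> l i (x \<oplus>\<^bsub>V\<^esub> y) = l i x + l i y"
    and l_smult: "\<And>i c x. i \<in> I \<Longrightarrow> x \<in> carrier V \<Longrightarrow> l i (c \<odot>\<^bsub>V\<^esub> x) = c * l i x"
    and l_dual: "\<And>i j. i \<in> I \<Longrightarrow> j \<in> I \<Longrightarrow> l i (q j) = (if i = j then 1 else 0)"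
    and l_kernel: "\<And>x. x \<in> carrier V \<Longrightarrow> (\<And>i. i \<in> I \<Longrightarrow> l i x = 0) \<Longrightarrow> x = \<zero>\<^bsub>V\<^esub>"
  shows "inj_on q I" "vectorspace.basis class_ring V (q ` I)"
    "vectorspace.dim class_ring V = card I"
proof -
  interpret vectorspace class_ring V by (rule V)
  show inj: "inj_on q I"
    by (rule inj_onI) (metis l_dual zero_neq_one)
  have l0: "l i \<zero>\<^bsub>V\<^esub> = 0" if "i \<in> I" for i
    using l_smult[OF that zero_closed, of 0] by simp
  have lsum: "l i (finsum V f A) = (\<Sum>a\<in>A. l i (f a))"
    if "i \<in> I" "finite A" "f \<in> A \<rightarrow> carrier V" for i and f :: "'v \<Rightarrow> 'v" and A
    using that(2,3)
  proof (induction A rule: finite_induct)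
    case empty
    then show ?case by (simp add: l0 that)
  next
    case (insert x A)
    then show ?case
      by (simp add: finsum_insert l_add that Pi_iff)
  qed
  have llin: "l i (lincomb a (q ` I)) = a (q i)" if i: "i \<in> I" for i a
  proof -
    have "l i (lincomb a (q ` I)) = (\<Sum>v\<in>q ` I. l i (a v \<odot>\<^bsub>V\<^esub> v))"
      unfolding lincomb_def using q finite_I i by (intro lsum) auto
    also have "\<dots> = (\<Sum>v\<in>q ` I. a v * l i v)"
      using q i by (intro sum.cong) (auto simp: l_smult)
    also have "\<dots> = (\<Sum>j\<in>I. a (q j) * l i (q j))"
      by (simp add: sum.reindex[OF inj])
    also have "\<dots> = (\<Sum>j\<in>I. if i = j then a (q j) else 0)"
      using i by (intro sum.cong) (auto simp: l_dual)
    finally show ?thesis using i finite_I by simp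
  qed
  have "lin_indpt (q ` I)"
  proof (rule finite_lin_indpt2)
    fix a :: "'v \<Rightarrow> 'a" assume "lincomb a (q ` I) = \<zero>\<^bsub>V\<^esub>"
    then show "\<forall>v\<in>q ` I. a v = \<zero>\<^bsub>class_ring\<^esub>"
      using llin[of _ a] l0 by auto
  qed (use q finite_I in auto)
  moreover have "gen_set (q ` I)"
  proof -
    have "x \<in> span (q ` I)" if x: "x \<in> carrier V" for x
    proof -
      define a where "a = (\<lambda>v. l (inv_into I q v) x)"
      have a: "a (q i) = l i x" if "i \<in> I" for i
        using that inj by (simp add: a_def)
      define y where "y = lincomb a (q ` I)"
      have y: "y \<in> carrier V" unfolding y_def using q by (intro lincomb_closed) auto
      have "x \<oplus>\<^bsub>V\<^esub> (- 1) \<odot>\<^bsub>V\<^esub> y = \<zero>\<^bsub>V\<^esub>"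
      proof (rule l_kernel)
        show "l i (x \<oplus>\<^bsub>V\<^esub> (- 1) \<odot>\<^bsub>V\<^esub> y) = 0" if "i \<in> I" for i
          using that x y by (simp add: l_add l_smult) (simp add: y_def llin a)
      qed (use x y in simp)
      then have "x = y"
      proof -
        have "(- 1) \<odot>\<^bsub>V\<^esub> y = \<ominus>\<^bsub>V\<^esub> y"
          using smult_l_minus[of 1 y] smult_one[OF y] y by (simp add: class_ring_simps)
        with \<open>x \<oplus>\<^bsub>V\<^esub> (- 1) \<odot>\<^bsub>V\<^esub> y = \<zero>\<^bsub>V\<^esub>\<close> show ?thesis
          using x y minus_equality[of x "\<ominus>\<^bsub>V\<^esub> y"] by simp
      qed
      moreover have "y \<in> span (q ` I)"
        unfolding y_def span_def using finite_I by (auto intro!: exI[of _ a] exI[of _ "q ` I"])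
      ultimately show ?thesis by simp
    qed
    then show ?thesis
      using span_is_subset2[OF q] by blast
  qed
  ultimately show B: "basis (q ` I)"
    using q by (simp add: basis_def)
  show "dim = card I"
    using dim_basis[OF _ B] finite_I card_image[OF inj] by simp
qed

context
  fixes M :: "('a::field, 'v, 'm) module_scheme" and N :: "'v set"
  assumes V: "vectorspace class_ring M" and N: "additive_subgroup N M"
    and smult_N: "\<forall>c. \<forall>x\<in>N. c \<odot>\<^bsub>M\<^esub> x \<in> N"
begin

interpretation vectorspace class_ring M by (rule V)

interpretation abelian_subgroup N M
  by (intro abelian_subgroupI3 N) unfold_locales

lemma quotient_module_carrier: "carrier (quotient_module M N) = (\<lambda>x. N +>\<^bsub>M\<^esub> x) ` carrier M"
  by (auto simp: quotient_module_def A_RCOSETS_def')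

lemma quotient_module_zero: "\<zero>\<^bsub>quotient_module M N\<^esub> = N"
  by (simp add: quotient_module_def)

lemma quotient_module_add:
  "x \<in> carrier M \<Longrightarrow> y \<in> carrier M \<Longrightarrow>
    (N +>\<^bsub>M\<^esub> x) \<oplus>\<^bsub>quotient_module M N\<^esub> (N +>\<^bsub>M\<^esub> y) = N +>\<^bsub>M\<^esub> (x \<oplus>\<^bsub>M\<^esub> y)"
  by (simp add: quotient_module_def a_rcos_sum)

lemma coset_eq_subgroup_iff: "x \<in> carrier M \<Longrightarrow> N +>\<^bsub>M\<^esub> x = N \<longleftrightarrow> x \<in> N"
  using a_coset_join1 a_coset_join2 a_subgroup a_subset by blast

text \<open>Two representatives of a coset differ by some \<open>n\<close> in \<open>N\<close>, and
  its multiple by \<open>c\<close> lies in \<open>N\<close> again by \<open>smult_N\<close>; so all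
  sets in the union that defines the scalar multiplication coincide.\<close>

lemma quotient_module_smult:
  assumes x: "x \<in> carrier M"
  shows "c \<odot>\<^bsub>quotient_module M N\<^esub> (N +>\<^bsub>M\<^esub> x) = N +>\<^bsub>M\<^esub> (c \<odot>\<^bsub>M\<^esub> x)"
proof -
  have "N +>\<^bsub>M\<^esub> (c \<odot>\<^bsub>M\<^esub> v) = N +>\<^bsub>M\<^esub> (c \<odot>\<^bsub>M\<^esub> x)" if v: "v \<in> N +>\<^bsub>M\<^esub> x" for v
  proof -
    obtain n where n: "n \<in> N" "v = n \<oplus>\<^bsub>M\<^esub> x"
      using v by (auto simp: a_r_coset_def')
    have nM: "n \<in> carrier M" using n a_subset by blast
    have "N +>\<^bsub>M\<^esub> (c \<odot>\<^bsub>M\<^esub> v) = (N +>\<^bsub>M\<^esub> (c \<odot>\<^bsub>M\<^esub> n)) <+>\<^bsub>M\<^esub> (N +>\<^bsub>M\<^esub> (c \<odot>\<^bsub>M\<^esub> x))"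
      using nM x by (simp add: n smult_r_distr a_rcos_sum)
    also have "N +>\<^bsub>M\<^esub> (c \<odot>\<^bsub>M\<^esub> n) = N"
      using smult_N n(1) nM by (simp add: coset_eq_subgroup_iff)
    also have "N <+>\<^bsub>M\<^esub> (N +>\<^bsub>M\<^esub> (c \<odot>\<^bsub>M\<^esub> x)) = N +>\<^bsub>M\<^esub> (c \<odot>\<^bsub>M\<^esub> x)"
      using x by (intro rcosets_add_eq a_rcosetsI a_subset) auto
    finally show ?thesis .
  qed
  moreover have "N +>\<^bsub>M\<^esub> x \<noteq> {}" using a_rcos_self[OF x] by blast
  ultimately have "(\<Union>v\<in>N +>\<^bsub>M\<^esub> x. N +>\<^bsub>M\<^esub> (c \<odot>\<^bsub>M\<^esub> v)) = N +>\<^bsub>M\<^esub> (c \<odot>\<^bsub>M\<^esub> x)"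
    by (intro SUP_eq_const)
  then show ?thesis
    unfolding quotient_module_def by simp
qed

lemma vectorspace_quotient_module: "vectorspace class_ring (quotient_module M N)"
proof -
  note simps = quotient_module_carrier quotient_module_add quotient_module_smult
  \<comment> \<open>With the zero element written as the coset of zero, every axiom reduces to the
    same axiom in \<open>M\<close> by the rules in \<open>simps\<close>.\<close>
  have zero: "\<zero>\<^bsub>quotient_module M N\<^esub> = N +>\<^bsub>M\<^esub> \<zero>\<^bsub>M\<^esub>"
    by (simp add: quotient_module_zero a_subset)
  have "abelian_group (quotient_module M N)"
  proof (rule abelian_groupI)
    fix A assume "A \<in> carrier (quotient_module M N)"
    then obtain x where x: "x \<in> carrier M" "A = N +>\<^bsub>M\<^esub> x"
      by (auto simp: simps)
    then have "(N +>\<^bsub>M\<^esub> (\<ominus>\<^bsub>M\<^esub> x)) \<oplus>\<^bsub>quotient_module M N\<^esub> A = \<zero>\<^bsub>quotient_module M N\<^esub>"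
      by (simp add: simps zero l_neg)
    then show "\<exists>B\<in>carrier (quotient_module M N). B \<oplus>\<^bsub>quotient_module M N\<^esub> A = \<zero>\<^bsub>quotient_module M N\<^esub>"
      using x by (auto simp: quotient_module_carrier)
  qed (auto simp: simps zero a_ac)
  then have "Module.module class_ring (quotient_module M N)"
    by (intro moduleI class_cring.is_cring) (auto simp: simps smult_l_distr[simplified] smult_r_distr smult_assoc1[simplified]
        smult_one[simplified])
  then show ?thesis
    by (rule vectorspace.intro) (rule vectorspace.axioms(2)[OF V])
qed

end

text \<open>The forms \<open>l i\<close> vanish on \<open>N\<close> and hence descend to the
  quotient. They stay dual to the classes of the \<open>w i\<close>, and since \<open>N\<close> is
  their whole common kernel, only the zero coset is killed by all of them.\<close>

lemma quotient_basis_of_dual_family: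
  fixes M :: "('a::field, 'v, 'm) module_scheme" and w :: "'i \<Rightarrow> 'v" and l :: "'i \<Rightarrow> 'v \<Rightarrow> 'a"
  assumes V: "vectorspace class_ring M" and finite_I: "finite I"
    and w: "w ` I \<subseteq> carrier M"
    and l_add: "\<And>i x y. i \<in> I \<Longrightarrow> x \<in> carrier M \<Longrightarrow> y \<in> carrier M \<Longrightarrow> l i (x \<oplus>\<^bsub>M\<^esub> y) = l i x + l i y"
    and l_smult: "\<And>i c x. i \<in> I \<Longrightarrow> x \<in> carrier M \<Longrightarrow> l i (c \<odot>\<^bsub>M\<^esub> x) = c * l i x"
    and l_dual: "\<And>i j. i \<in> I \<Longrightarrow> j \<in> I \<Longrightarrow> l i (w j) = (if i = j then 1 else 0)"
    and N: "N = {x \<in> carrier M. \<forall>i\<in>I. l i x = 0}"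
  shows "inj_on (\<lambda>i. N +>\<^bsub>M\<^esub> w i) I"
    "vectorspace.basis class_ring (quotient_module M N) ((\<lambda>i. N +>\<^bsub>M\<^esub> w i) ` I)"
    "vectorspace.dim class_ring (quotient_module M N) = card I"
proof -
  interpret vectorspace class_ring M by (rule V)
  have l_zero: "l i \<zero>\<^bsub>M\<^esub> = 0" if "i \<in> I" for i
    using l_smult[OF that zero_closed, of 0] by simp
  have l_minus: "l i (\<ominus>\<^bsub>M\<^esub> x) = - l i x" if "i \<in> I" "x \<in> carrier M" for i x
    using l_add[OF that(1) a_inv_closed[OF that(2)] that(2)] that
    by (simp add: l_neg l_zero eq_neg_iff_add_eq_0)
  have "subgroup N (add_monoid M)"
    by (rule add.subgroupI) (auto simp: N l_add l_zero l_minus simp flip: a_inv_def intro!: exI[of _ "\<zero>\<^bsub>M\<^esub>"])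
  then have N1: "additive_subgroup N M"
    by (simp add: additive_subgroup_def)
  have N2: "\<forall>c. \<forall>x\<in>N. c \<odot>\<^bsub>M\<^esub> x \<in> N"
    by (simp add: N l_smult)
  interpret abelian_subgroup N M
    by (intro abelian_subgroupI3 N1) unfold_locales
  note simps = quotient_module_carrier[OF V N1 N2] quotient_module_add[OF V N1 N2]
    quotient_module_smult[OF V N1 N2]
  \<comment> \<open>The induced form evaluates \<open>l i\<close> at a chosen representative; the
    next fact shows that the choice does not matter.\<close>
  define L where "L = (\<lambda>i A. l i (SOME v. v \<in> A))"
  have L: "L i (N +>\<^bsub>M\<^esub> x) = l i x" if i: "i \<in> I" and x: "x \<in> carrier M" for i x
  proof -
    have "(SOME v. v \<in> N +>\<^bsub>M\<^esub> x) \<in> N +>\<^bsub>M\<^esub> x"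
      using a_rcos_self[OF x] by (rule someI)
    then obtain n where n: "n \<in> N" and eq: "(SOME v. v \<in> N +>\<^bsub>M\<^esub> x) = n \<oplus>\<^bsub>M\<^esub> x"
      by (auto simp: a_r_coset_def')
    have "n \<in> carrier M" "l i n = 0"
      using n i unfolding N by blast+
    then show ?thesis
      unfolding L_def eq using l_add[OF i _ x] by simp
  qed
  have vs: "vectorspace class_ring (quotient_module M N)"
    by (rule vectorspace_quotient_module[OF V N1 N2])
  have kernel: "A = \<zero>\<^bsub>quotient_module M N\<^esub>"
    if A_carrier: "A \<in> carrier (quotient_module M N)" and L_A: "\<And>i. i \<in> I \<Longrightarrow> L i A = 0" for A
  proof -
    obtain x where x: "x \<in> carrier M" and A: "A = N +>\<^bsub>M\<^esub> x"
      using A_carrier by (auto simp: simps)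
    then have "l i x = 0" if "i \<in> I" for i
      using L_A[OF that] that by (simp add: L)
    with x have "x \<in> N"
      unfolding N by blast
    then show ?thesis
      using x by (simp add: A quotient_module_zero[OF V N1 N2] coset_eq_subgroup_iff[OF V N1 N2])
  qed
  have w': "w i \<in> carrier M" if "i \<in> I" for i
    using w that by blast
  have Q1: "(\<lambda>i. N +>\<^bsub>M\<^esub> w i) ` I \<subseteq> carrier (quotient_module M N)"
    using w' by (auto simp: simps)
  have Q2: "L i (A \<oplus>\<^bsub>quotient_module M N\<^esub> B) = L i A + L i B"
    if "i \<in> I" "A \<in> carrier (quotient_module M N)" "B \<in> carrier (quotient_module M N)" for i A B
    using that by (auto simp: simps L l_add)
  have Q3: "L i (c \<odot>\<^bsub>quotient_module M N\<^esub> A) = c * L i A"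
    if "i \<in> I" "A \<in> carrier (quotient_module M N)" for i c A
    using that by (auto simp: simps L l_smult)
  have Q4: "L i (N +>\<^bsub>M\<^esub> w j) = (if i = j then 1 else 0)" if "i \<in> I" "j \<in> I" for i j
    using that w' by (simp add: L l_dual)
  note basis = vectorspace_basis_of_dual_family[of "quotient_module M N" I "\<lambda>i. N +>\<^bsub>M\<^esub> w i" L,
      OF vs finite_I Q1 Q2 Q3 Q4 kernel]
  show "inj_on (\<lambda>i. N +>\<^bsub>M\<^esub> w i) I"
    by (rule basis(1))
  show "vectorspace.basis class_ring (quotient_module M N) ((\<lambda>i. N +>\<^bsub>M\<^esub> w i) ` I)"
    by (rule basis(2))
  show "vectorspace.dim class_ring (quotient_module M N) = card I"
    by (rule basis(3))
qed

section \<open>Coordinates on the model filiform superalgebra\<close>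

fun parity :: "gen \<Rightarrow> nat" where
  "parity (X i) = 0"
| "parity (Y i) = 1"

lemma parity_less_2: "parity g < 2"
  by (cases g) auto

lemma finite_gens [simp]: "finite (gens p)"
  by (simp add: gens_def)

lemma X_in_gens [simp]: "X i \<in> gens p \<longleftrightarrow> 1 \<le> i \<and> i \<le> p"
  and Y_in_gens [simp]: "Y i \<in> gens p \<longleftrightarrow> 1 \<le> i \<and> i \<le> p"
  by (auto simp: gens_def)

definition vecs :: "nat \<Rightarrow> (gen \<Rightarrow> 'a::field) set" where
  "vecs p = {v. \<forall>g. g \<notin> gens p \<longrightarrow> v g = 0}"

lemma basis_vec_in_vecs [simp]: "g \<in> gens p \<Longrightarrow> basis_vec g \<in> vecs p"
  by (auto simp: vecs_def basis_vec_def)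

lemma add_in_vecs [simp]: "u \<in> vecs p \<Longrightarrow> v \<in> vecs p \<Longrightarrow> (\<lambda>g. u g + v g) \<in> vecs p"
  and smult_in_vecs [simp]: "v \<in> vecs p \<Longrightarrow> (\<lambda>g. c * v g) \<in> vecs p"
  by (simp_all add: vecs_def)

lemma sum_basis_vec_mult [simp]:
  "g \<in> gens p \<Longrightarrow> (\<Sum>h\<in>gens p. basis_vec g h * f h) = (f g :: 'a::field)"
proof -
  assume g: "g \<in> gens p"
  have "(\<Sum>h\<in>gens p. basis_vec g h * f h) = (\<Sum>h\<in>gens p. if h = g then f h else 0)"
    by (intro sum.cong) (auto simp: basis_vec_def)
  then show ?thesis using g by simp
qed

lemma model_filiform_simps [simp]:
  "carrier (model_filiform p lam) = vecs p"
  "x \<oplus>\<^bsub>model_filiform p lam\<^esub> y = (\<lambda>g. x g + y g)"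
  "c \<odot>\<^bsub>model_filiform p lam\<^esub> x = (\<lambda>g. c * x g)"
  "bracket (model_filiform p lam) u v =
    (\<lambda>h. \<Sum>a\<in>gens p. \<Sum>b\<in>gens p. u a * v b * basis_bracket p a b h)"
  by (simp_all add: model_filiform_def vecs_def)

lemma hom_part_model_filiform:
  "x \<in> hom_part (model_filiform p lam) a \<longleftrightarrow> x \<in> vecs p \<and> (\<forall>g. parity g \<noteq> a mod 2 \<longrightarrow> x g = 0)"
proof -
  have "g \<notin> (if even a then X ` {1..p} else Y ` {1..p}) \<longleftrightarrow> g \<notin> gens p \<or> parity g \<noteq> a mod 2" for g
    by (cases g) (auto simp: image_iff odd_iff_mod_2_eq_one)
  moreover have "x \<in> hom_part (model_filiform p lam) a \<longleftrightarrow>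
      (\<forall>g. g \<notin> (if even a then X ` {1..p} else Y ` {1..p}) \<longrightarrow> x g = 0)"
    by (simp add: hom_part_def model_filiform_def)
  ultimately show ?thesis
    unfolding vecs_def by blast
qed

lemma hom_part_imp_vecs: "x \<in> hom_part (model_filiform p lam) a \<Longrightarrow> x \<in> vecs p"
  by (simp add: hom_part_model_filiform)

lemma basis_vec_in_hom_part:
  "g \<in> gens p \<Longrightarrow> basis_vec g \<in> hom_part (model_filiform p lam) (parity g)"
  using parity_less_2[of g] by (simp add: hom_part_model_filiform) (auto simp: basis_vec_def)

text \<open>In a decomposition \<open>x = y + z\<close> into opposite parities, \<open>y\<close> and
  \<open>z\<close> have disjoint supports, so \<open>y\<close> can only be a restriction of
  \<open>x\<close>. This is the uniqueness that the definite description requires.\<close>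

lemma hom_comp_model_filiform:
  assumes x: "x \<in> vecs p"
  shows "hom_comp (model_filiform p lam) a x = (\<lambda>g. if parity g = a mod 2 then x g else 0)"
  unfolding hom_comp_def
proof (rule the_equality)
  have parity_Suc: "parity g = a mod 2" if "parity g \<noteq> Suc a mod 2" for g
    using that parity_less_2[of g] by presburger
  show "(\<lambda>g. if parity g = a mod 2 then x g else 0) \<in> hom_part (model_filiform p lam) a \<and>
    (\<exists>z\<in>hom_part (model_filiform p lam) (Suc a).
      x = (\<lambda>g. if parity g = a mod 2 then x g else 0) \<oplus>\<^bsub>model_filiform p lam\<^esub> z)"
    using x parity_Suc
    by (auto simp: hom_part_model_filiform vecs_def
        intro!: bexI[of _ "\<lambda>g. if parity g = a mod 2 then 0 else x g"])
  fix y
  assume "y \<in> hom_part (model_filiform p lam) a \<and>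
    (\<exists>z\<in>hom_part (model_filiform p lam) (Suc a). x = y \<oplus>\<^bsub>model_filiform p lam\<^esub> z)"
  then obtain z where y: "\<forall>g. parity g \<noteq> a mod 2 \<longrightarrow> y g = 0"
    and z: "\<forall>g. parity g \<noteq> Suc a mod 2 \<longrightarrow> z g = 0" and eq: "x = (\<lambda>g. y g + z g)"
    by (auto simp: hom_part_model_filiform Bex_def)
  have "z g = 0" if "parity g = a mod 2" for g
  proof -
    have "parity g \<noteq> Suc a mod 2" using that by presburger
    with z show ?thesis by blast
  qed
  with y show "y = (\<lambda>g. if parity g = a mod 2 then x g else 0)"
    by (auto simp: eq)
qed

text \<open>The vector is rebuilt one label at a time: the induction runs over the set of labels on
  which \<open>v\<close> is kept.\<close>

lemma linear_form_eq_sum: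
  fixes F :: "(gen \<Rightarrow> 'a::field) \<Rightarrow> 'a"
  assumes F_add: "\<And>u v. u \<in> vecs p \<Longrightarrow> v \<in> vecs p \<Longrightarrow> F (\<lambda>g. u g + v g) = F u + F v"
    and F_smult: "\<And>c v. v \<in> vecs p \<Longrightarrow> F (\<lambda>g. c * v g) = c * F v"
    and v: "v \<in> vecs p"
  shows "F v = (\<Sum>a\<in>gens p. v a * F (basis_vec a))"
proof -
  have restrict_in: "(\<lambda>g. if g \<in> S then v g else 0) \<in> vecs p" for S
    using v by (simp add: vecs_def)
  have "F (\<lambda>g. if g \<in> S then v g else 0) = (\<Sum>a\<in>S. v a * F (basis_vec a))"
    if "finite S" "S \<subseteq> gens p" for S
    using that
  proof (induction S rule: finite_induct)
    case empty
    then show ?case using F_smult[OF v, of 0] by simp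
  next
    case (insert a S)
    have "(\<lambda>g. if g \<in> insert a S then v g else 0)
        = (\<lambda>g. v a * basis_vec a g + (if g \<in> S then v g else 0))"
      using insert.hyps by (auto simp: basis_vec_def)
    with insert restrict_in show ?case
      by (simp add: F_add F_smult)
  qed
  from this[of "gens p"] have "F (\<lambda>g. if g \<in> gens p then v g else 0) = (\<Sum>a\<in>gens p. v a * F (basis_vec a))"
    by simp
  also have "(\<lambda>g. if g \<in> gens p then v g else 0) = v"
    using v by (auto simp: vecs_def)
  finally show ?thesis .
qed

section \<open>2-cochains as matrices\<close>

lemma bilinear_cochain_eq:
  "bilinear_cochain p m xs = (if length xs = 2 \<and> set xs \<subseteq> vecs p
    then \<Sum>a\<in>gens p. \<Sum>b\<in>gens p. (xs ! 0) a * (xs ! 1) b * m a b else 0)"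
  unfolding bilinear_cochain_def vecs_def subset_iff mem_Collect_eq Ball_def ..

lemma bilinear_cochain_pair:
  "u \<in> vecs p \<Longrightarrow> v \<in> vecs p \<Longrightarrow>
    bilinear_cochain p m [u, v] = (\<Sum>a\<in>gens p. \<Sum>b\<in>gens p. u a * v b * m a b)"
  by (simp add: bilinear_cochain_def vecs_def)

lemma bilinear_cochain_eq_0:
  "\<not> (length xs = 2 \<and> set xs \<subseteq> vecs p) \<Longrightarrow> bilinear_cochain p m xs = 0"
  by (auto simp: bilinear_cochain_def vecs_def)

lemma bilinear_cochain_basis [simp]:
  assumes "a \<in> gens p" "b \<in> gens p"
  shows "bilinear_cochain p m [basis_vec a, basis_vec b] = m a b"
  using assms by (simp add: bilinear_cochain_pair mult.assoc flip: sum_distrib_left)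

lemma bilinear_cochain_cong:
  "(\<And>a b. a \<in> gens p \<Longrightarrow> b \<in> gens p \<Longrightarrow> m a b = m' a b) \<Longrightarrow> bilinear_cochain p m = bilinear_cochain p m'"
  by (auto simp: bilinear_cochain_def fun_eq_iff intro!: sum.cong)

lemma bilinear_cochain_add:
  "bilinear_cochain p m xs + bilinear_cochain p m' xs = bilinear_cochain p (\<lambda>a b. m a b + m' a b) xs"
  by (simp add: bilinear_cochain_eq sum.distrib ring_distribs)

lemma bilinear_cochain_smult:
  "c * bilinear_cochain p m xs = bilinear_cochain p (\<lambda>a b. c * m a b) xs"
  by (simp add: bilinear_cochain_eq sum_distrib_left ac_simps)

lemma bilinear_cochain_zero: "bilinear_cochain p (\<lambda>a b. 0) xs = 0"
  by (simp add: bilinear_cochain_def)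

lemma bilinear_cochain_sum:
  "(\<Sum>i\<in>I. c i * bilinear_cochain p (m i) xs) = bilinear_cochain p (\<lambda>a b. \<Sum>i\<in>I. c i * m i a b) xs"
  by (induction I rule: infinite_finite_induct)
    (simp_all add: bilinear_cochain_zero bilinear_cochain_smult bilinear_cochain_add)

text \<open>The relation of the super-exterior square on basis vectors: antisymmetry on the XX and
  XY blocks, symmetry on the YY block.\<close>

definition supersymmetric :: "nat \<Rightarrow> (gen \<Rightarrow> gen \<Rightarrow> 'a::field) \<Rightarrow> bool" where
  "supersymmetric p m \<longleftrightarrow>
    (\<forall>a\<in>gens p. \<forall>b\<in>gens p. m a b + (-1) ^ (parity a * parity b) * m b a = 0)"

lemma bilinear_cochain_in_cochains:
  assumes m: "supersymmetric p m"
  shows "bilinear_cochain p m \<in> cochains (model_filiform p lam) 2"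
proof -
  \<comment> \<open>With two arguments in all, the context of a varied slot is a single vector, to
    its left or to its right.\<close>
  have lists: "(us = [] \<and> (\<exists>u. vs = [u])) \<or> (vs = [] \<and> (\<exists>u. us = [u]))"
    if "length us + length vs + 1 = 2" for us vs :: "(gen \<Rightarrow> 'a) list"
    using that by (cases us; cases vs) auto
  have "bilinear_cochain p m [x, y] + (-1) ^ (a * b) * bilinear_cochain p m [y, x] = 0"
    if x: "x \<in> hom_part (model_filiform p lam) a" and y: "y \<in> hom_part (model_filiform p lam) b" for x y a b
  proof -
    have xy: "x \<in> vecs p" "y \<in> vecs p"
      using x y by (simp_all add: hom_part_imp_vecs)
    have "bilinear_cochain p m [y, x] = (\<Sum>c\<in>gens p. \<Sum>d\<in>gens p. x c * y d * m d c)"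
      unfolding bilinear_cochain_pair[OF xy(2,1)] by (subst sum.swap) (simp add: mult.commute)
    then have "bilinear_cochain p m [x, y] + (-1) ^ (a * b) * bilinear_cochain p m [y, x]
        = (\<Sum>c\<in>gens p. \<Sum>d\<in>gens p. x c * y d * (m c d + (-1) ^ (a * b) * m d c))"
      by (simp add: bilinear_cochain_pair[OF xy] sum_distrib_left sum.distrib algebra_simps)
    also have "\<dots> = 0"
    proof (intro sum.neutral ballI)
      fix c d assume cd: "c \<in> gens p" "d \<in> gens p"
      show "x c * y d * (m c d + (-1) ^ (a * b) * m d c) = 0"
      \<comment> \<open>A homogeneous vector has nonzero coordinates only at labels of its own
        parity. So whenever the product does not vanish, the sign given by \<open>a\<close> and
        \<open>b\<close> is the one given by the labels.\<close>
      proof (cases "x c = 0 \<or> y d = 0")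
        case False
        then have "parity c = a mod 2" "parity d = b mod 2"
          using x y by (auto simp: hom_part_model_filiform)
        then have "even (parity c * parity d) \<longleftrightarrow> even (a * b)"
          by (simp add: even_mult_iff)
        then have "(-1 :: 'a) ^ (a * b) = (-1) ^ (parity c * parity d)"
          by (simp add: minus_one_power_iff)
        then show ?thesis
          using m cd by (simp add: supersymmetric_def)
      qed auto
    qed
    finally show ?thesis .
  qed
  moreover have "bilinear_cochain p m (us @ (\<lambda>g. x g + y g) # vs)
      = bilinear_cochain p m (us @ x # vs) + bilinear_cochain p m (us @ y # vs)"
    if "length us + length vs + 1 = 2" "set us \<union> {x, y} \<union> set vs \<subseteq> vecs p" for us vs x y
    using lists[OF that(1)] that(2)
    by (auto simp: bilinear_cochain_pair ring_distribs sum.distrib)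
  moreover have "bilinear_cochain p m (us @ (\<lambda>g. c * x g) # vs) = c * bilinear_cochain p m (us @ x # vs)"
    if "length us + length vs + 1 = 2" "set us \<union> {x} \<union> set vs \<subseteq> vecs p" for us vs x c
    using lists[OF that(1)] that(2)
    by (auto simp: bilinear_cochain_pair sum_distrib_left ac_simps)
  ultimately show ?thesis
    using bilinear_cochain_eq_0[of _ p m] by (auto simp: cochains_def)
qed

text \<open>Linearity in the first slot and then in the second expands a 2-cochain over the basis;
  on other lists both sides are 0 by convention. Together with
  \<open>bilinear_cochain_in_cochains\<close> this identifies 2-cochains with supersymmetric
  matrices indexed by \<open>gens p\<close>.\<close>

lemma cochain2_eq_bilinear_cochain:
  assumes \<alpha>: "\<alpha> \<in> cochains (model_filiform p lam) 2"
  shows "\<alpha> = bilinear_cochain p (\<lambda>a b. \<alpha> [basis_vec a, basis_vec b])"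
    and "supersymmetric p (\<lambda>a b. \<alpha> [basis_vec a, basis_vec b])"
proof -
  have clauses: "\<And>xs. \<not> (length xs = 2 \<and> set xs \<subseteq> vecs p) \<Longrightarrow> \<alpha> xs = 0"
    "\<And>us x y vs. length us + length vs + 1 = 2 \<Longrightarrow> set us \<union> {x, y} \<union> set vs \<subseteq> vecs p \<Longrightarrow>
        \<alpha> (us @ (\<lambda>g. x g + y g) # vs) = \<alpha> (us @ x # vs) + \<alpha> (us @ y # vs)"
    "\<And>us c x vs. length us + length vs + 1 = 2 \<Longrightarrow> set us \<union> {x} \<union> set vs \<subseteq> vecs p \<Longrightarrow>
        \<alpha> (us @ (\<lambda>g. c * x g) # vs) = c * \<alpha> (us @ x # vs)"
    "\<And>x y a b. x \<in> hom_part (model_filiform p lam) a \<Longrightarrow> y \<in> hom_part (model_filiform p lam) b \<Longrightarrow>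
        \<alpha> [x, y] + (-1) ^ (a * b) * \<alpha> [y, x] = 0"
    using \<alpha>[unfolded cochains_def model_filiform_simps mem_Collect_eq]
    by (blast, blast, blast, elim conjE allE[of _ "[]"]) simp
  have "\<alpha> [u, v] = (\<Sum>a\<in>gens p. \<Sum>b\<in>gens p. u a * v b * \<alpha> [basis_vec a, basis_vec b])"
    if "u \<in> vecs p" "v \<in> vecs p" for u v
  proof -
    have "\<alpha> [u, v] = (\<Sum>a\<in>gens p. u a * \<alpha> [basis_vec a, v])"
      using clauses(2)[of "[]" "[v]"] clauses(3)[of "[]" "[v]"] that
      by (intro linear_form_eq_sum[where F = "\<lambda>u. \<alpha> [u, v]"]) auto
    also have "\<dots> = (\<Sum>a\<in>gens p. u a * (\<Sum>b\<in>gens p. v b * \<alpha> [basis_vec a, basis_vec b]))"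
    proof (intro sum.cong refl arg_cong2[where f = "(*)"])
      fix a assume "a \<in> gens p"
      then show "\<alpha> [basis_vec a, v] = (\<Sum>b\<in>gens p. v b * \<alpha> [basis_vec a, basis_vec b])"
        using clauses(2)[of "[basis_vec a]" "[]"] clauses(3)[of "[basis_vec a]" "[]"] that
        by (intro linear_form_eq_sum[where F = "\<lambda>v. \<alpha> [basis_vec a, v]"]) auto
    qed
    finally show ?thesis
      by (simp add: sum_distrib_left mult.assoc)
  qed
  note pair = this
  show "\<alpha> = bilinear_cochain p (\<lambda>a b. \<alpha> [basis_vec a, basis_vec b])"
  proof
    fix xs
    show "\<alpha> xs = bilinear_cochain p (\<lambda>a b. \<alpha> [basis_vec a, basis_vec b]) xs"
    proof (cases "length xs = 2 \<and> set xs \<subseteq> vecs p")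
      case True
      then obtain u v where "xs = [u, v]" "u \<in> vecs p" "v \<in> vecs p"
        by (auto simp: numeral_2_eq_2 length_Suc_conv)
      then show ?thesis
        using pair[of u v] by (simp only: bilinear_cochain_pair)
    next
      case False
      then show ?thesis
        using clauses(1)[of xs] bilinear_cochain_eq_0[of xs p] by metis
    qed
  qed
  show "supersymmetric p (\<lambda>a b. \<alpha> [basis_vec a, basis_vec b])"
    using clauses(4) basis_vec_in_hom_part unfolding supersymmetric_def by blast
qed

lemma cochain1_eq_sum:
  assumes \<phi>: "\<phi> \<in> cochains (model_filiform p lam) 1" and v: "v \<in> vecs p"
  shows "\<phi> [v] = (\<Sum>a\<in>gens p. v a * \<phi> [basis_vec a])"
proof (rule linear_form_eq_sum[OF _ _ v])
  have clauses: "\<forall>us x y vs. length us + length vs + 1 = 1 \<and> set us \<union> {x, y} \<union> set vs \<subseteq> vecs p \<longrightarrow>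
        \<phi> (us @ (\<lambda>g. x g + y g) # vs) = \<phi> (us @ x # vs) + \<phi> (us @ y # vs)"
    "\<forall>us c x vs. length us + length vs + 1 = 1 \<and> set us \<union> {x} \<union> set vs \<subseteq> vecs p \<longrightarrow>
        \<phi> (us @ (\<lambda>g. c * x g) # vs) = c * \<phi> (us @ x # vs)"
    using \<phi>[unfolded cochains_def model_filiform_simps mem_Collect_eq] by blast+
  show "\<phi> [\<lambda>g. u g + v g] = \<phi> [u] + \<phi> [v]" if "u \<in> vecs p" "v \<in> vecs p" for u v
    using clauses(1)[rule_format, of "[]" "[]" u v] that by simp
  show "\<phi> [\<lambda>g. c * v g] = c * \<phi> [v]" if "v \<in> vecs p" for c v
    using clauses(2)[rule_format, of "[]" "[]" v c] that by simp
qed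

lemma linear_form_in_cochains1:
  "(\<lambda>xs. if length xs = 1 \<and> set xs \<subseteq> vecs p then \<Sum>a\<in>gens p. (xs ! 0) a * \<psi> a else 0)
    \<in> cochains (model_filiform p lam) 1"
  by (auto simp: cochains_def ring_distribs sum.distrib sum_distrib_left mult.assoc)

section \<open>Brackets in coordinates and coboundaries\<close>

text \<open>The composition of a linear form with \<open>ad X\<^sub>1\<close>, on basis vectors.\<close>

fun pullback_ad_X1 :: "nat \<Rightarrow> (gen \<Rightarrow> 'a::zero) \<Rightarrow> gen \<Rightarrow> 'a" where
  "pullback_ad_X1 p f (X i) = (if 2 \<le> i \<and> i < p then f (X (Suc i)) else 0)"
| "pullback_ad_X1 p f (Y j) = (if 1 \<le> j \<and> j < p then f (Y (Suc j)) else 0)"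

text \<open>The sum is the linear form \<open>f\<close> evaluated at the bracket of \<open>a\<close>
  and \<open>b\<close>, and a nonzero bracket of basis vectors involves \<open>X 1\<close>. For
  \<open>a = b = X 1\<close> the first case applies and gives 0, as it should, because
  \<open>pullback_ad_X1\<close> vanishes at \<open>X 1\<close>.\<close>

lemma sum_basis_bracket_mult:
  fixes f :: "gen \<Rightarrow> 'a::field"
  assumes "p > 0" "a \<in> gens p" "b \<in> gens p"
  shows "(\<Sum>h\<in>gens p. basis_bracket p a b h * f h)
    = (if a = X 1 then pullback_ad_X1 p f b else if b = X 1 then - pullback_ad_X1 p f a else 0)"
  using assms by (cases a; cases b) (auto simp: sum_negf less_diff_conv Suc_le_eq)

lemma basis_bracket_in_vecs:
  "a \<in> gens p \<Longrightarrow> b \<in> gens p \<Longrightarrow> basis_bracket p a b \<in> vecs p"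
  by (cases a; cases b) (auto simp: vecs_def basis_vec_def gens_def)

lemma bracket_in_vecs:
  "bracket (model_filiform p lam) u v \<in> vecs p"
  using basis_bracket_in_vecs by (fastforce simp: vecs_def intro!: sum.neutral)

lemma sum_bracket_mult:
  fixes f :: "gen \<Rightarrow> 'a::field"
  shows "(\<Sum>h\<in>gens p. bracket (model_filiform p lam) u v h * f h)
    = (\<Sum>a\<in>gens p. \<Sum>b\<in>gens p. u a * v b * (\<Sum>h\<in>gens p. basis_bracket p a b h * f h))"
proof -
  have "(\<Sum>h\<in>gens p. bracket (model_filiform p lam) u v h * f h)
      = (\<Sum>h\<in>gens p. \<Sum>a\<in>gens p. \<Sum>b\<in>gens p. u a * v b * basis_bracket p a b h * f h)"
    by (simp add: sum_distrib_right)
  also have "\<dots> = (\<Sum>a\<in>gens p. \<Sum>h\<in>gens p. \<Sum>b\<in>gens p. u a * v b * basis_bracket p a b h * f h)"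
    by (rule sum.swap)
  also have "\<dots> = (\<Sum>a\<in>gens p. \<Sum>b\<in>gens p. \<Sum>h\<in>gens p. u a * v b * basis_bracket p a b h * f h)"
    by (intro sum.cong refl sum.swap)
  finally show ?thesis
    by (simp add: sum_distrib_left mult.assoc)
qed

text \<open>This is - f([a, b]), the matrix of d^1 of the linear form with values \<open>f\<close>
  on the basis.\<close>

definition coboundary_matrix :: "nat \<Rightarrow> (gen \<Rightarrow> 'a::field) \<Rightarrow> gen \<Rightarrow> gen \<Rightarrow> 'a" where
  "coboundary_matrix p f a b = (if a = X 1 then - pullback_ad_X1 p f b else if b = X 1 then pullback_ad_X1 p f a else 0)"

lemma coboundaries2_model_filiform:
  assumes p: "p > 0"
  shows "coboundaries2 (model_filiform p lam :: ('a::field, _) restricted_lie_superalgebra)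
    = range (\<lambda>f. bilinear_cochain p (coboundary_matrix p f))"
proof -
  let ?L = "model_filiform p lam :: ('a, _) restricted_lie_superalgebra"
  have d1: "cochain_d1 ?L \<phi> = bilinear_cochain p (coboundary_matrix p f)"
    if \<phi>: "\<And>v. v \<in> vecs p \<Longrightarrow> \<phi> [v] = (\<Sum>a\<in>gens p. v a * f a)" for \<phi> f
  proof
    fix xs
    show "cochain_d1 ?L \<phi> xs = bilinear_cochain p (coboundary_matrix p f) xs"
    proof (cases "length xs = 2 \<and> set xs \<subseteq> vecs p")
      case True
      have "\<phi> [bracket ?L (xs ! 0) (xs ! 1)] = (\<Sum>h\<in>gens p. bracket ?L (xs ! 0) (xs ! 1) h * f h)"
        by (rule \<phi>[OF bracket_in_vecs])
      also have "\<dots> = (\<Sum>a\<in>gens p. \<Sum>b\<in>gens p. - ((xs ! 0) a * (xs ! 1) b * coboundary_matrix p f a b))"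
        unfolding sum_bracket_mult using p
        by (intro sum.cong refl) (simp add: sum_basis_bracket_mult coboundary_matrix_def)
      also have "\<dots> = - bilinear_cochain p (coboundary_matrix p f) xs"
        using True by (simp add: bilinear_cochain_eq sum_negf)
      finally show ?thesis
        using True by (simp add: cochain_d1_def del: model_filiform_simps(4))
    next
      case False
      then show ?thesis
        by (auto simp: cochain_d1_def bilinear_cochain_eq)
    qed
  qed
  show ?thesis
  proof (intro equalityI subsetI)
    fix \<alpha> assume "\<alpha> \<in> coboundaries2 ?L"
    then obtain \<phi> where \<phi>: "\<phi> \<in> cochains ?L 1" and \<alpha>: "\<alpha> = cochain_d1 ?L \<phi>"
      by (auto simp: coboundaries2_def)
    have "\<alpha> = bilinear_cochain p (coboundary_matrix p (\<lambda>a. \<phi> [basis_vec a]))"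
      unfolding \<alpha> by (rule d1) (rule cochain1_eq_sum[OF \<phi>])
    then show "\<alpha> \<in> range (\<lambda>f. bilinear_cochain p (coboundary_matrix p f))" by blast
  next
    fix \<alpha> assume "\<alpha> \<in> range (\<lambda>f. bilinear_cochain p (coboundary_matrix p f :: _ \<Rightarrow> _ \<Rightarrow> 'a))"
    then obtain f where \<alpha>: "\<alpha> = bilinear_cochain p (coboundary_matrix p f)" by blast
    \<comment> \<open>Any prescribed values \<open>f\<close> on the basis come from a 1-cochain,
      namely the linear form with these coefficients.\<close>
    have "cochain_d1 ?L (\<lambda>xs. if length xs = 1 \<and> set xs \<subseteq> vecs p then \<Sum>a\<in>gens p. (xs ! 0) a * f a else 0) = \<alpha>"
      unfolding \<alpha> by (rule d1) simp
    then show "\<alpha> \<in> coboundaries2 ?L"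
      unfolding coboundaries2_def using linear_form_in_cochains1 by blast
  qed
qed

section \<open>Cocycles\<close>

text \<open>Here both shifted vectors stand in the first slot. For supersymmetric \<open>m\<close>
  the sign on the right comes from moving ad X_1 c, which has the parity of \<open>c\<close>, out of
  the second slot.\<close>

definition closed_matrix :: "nat \<Rightarrow> (gen \<Rightarrow> gen \<Rightarrow> 'a::field) \<Rightarrow> bool" where
  "closed_matrix p m \<longleftrightarrow> (\<forall>b\<in>gens p - {X 1}. \<forall>c\<in>gens p - {X 1}.
    pullback_ad_X1 p (\<lambda>h. m h c) b = (-1) ^ (parity b * parity c) * pullback_ad_X1 p (\<lambda>h. m h b) c)"

definition d2_matrix :: "nat \<Rightarrow> (gen \<Rightarrow> gen \<Rightarrow> 'a::field) \<Rightarrow> gen \<Rightarrow> gen \<Rightarrow> gen \<Rightarrow> 'a" where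
  "d2_matrix p m a b c =
    - (\<Sum>h\<in>gens p. basis_bracket p a b h * m h c)
    + (-1) ^ (parity b * parity c) * (\<Sum>h\<in>gens p. basis_bracket p a c h * m h b)
    - (-1) ^ (parity a * (parity b + parity c)) * (\<Sum>h\<in>gens p. basis_bracket p b c h * m h a)"

text \<open>If none of \<open>a\<close>, \<open>b\<close>, \<open>c\<close> is \<open>X 1\<close>,
  all three brackets vanish. If exactly one is, \<open>d2_matrix\<close> compares, up to sign, the
  two sides of the equation in \<open>closed_matrix\<close> for the other two. If at least two are,
  the terms vanish or cancel. Conversely, \<open>a = X 1\<close> already yields every
  equation.\<close>

lemma closed_matrix_iff_d2_matrix:
  assumes p: "p > 0"
  shows "closed_matrix p m \<longleftrightarrow> (\<forall>a\<in>gens p. \<forall>b\<in>gens p. \<forall>c\<in>gens p. d2_matrix p m a b c = 0)"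
proof (intro iffI ballI)
  fix a b c assume m: "closed_matrix p m" and abc: "a \<in> gens p" "b \<in> gens p" "c \<in> gens p"
  have pullback_X1: "pullback_ad_X1 p f (X 1) = 0" for f :: "gen \<Rightarrow> 'a" by simp
  have "(-1) ^ (parity u * parity v) * pullback_ad_X1 p (\<lambda>h. m h u) v = pullback_ad_X1 p (\<lambda>h. m h v) u"
    if "u \<in> gens p" "v \<in> gens p" "u \<noteq> X 1" "v \<noteq> X 1" for u v
    by (rule m[unfolded closed_matrix_def, rule_format, symmetric]) (use that in simp)+
  with abc show "d2_matrix p m a b c = 0"
    unfolding d2_matrix_def
    by (cases "a = X 1"; cases "b = X 1"; cases "c = X 1")
      (simp_all add: sum_basis_bracket_mult[OF p] pullback_X1[unfolded One_nat_def] del: pullback_ad_X1.simps)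
next
  assume d2: "\<forall>a\<in>gens p. \<forall>b\<in>gens p. \<forall>c\<in>gens p. d2_matrix p m a b c = 0"
  have "X 1 \<in> gens p" using p by simp
  show "closed_matrix p m"
    unfolding closed_matrix_def
  proof (intro ballI)
    fix b c assume "b \<in> gens p - {X 1}" "c \<in> gens p - {X 1}"
    moreover from this \<open>X 1 \<in> gens p\<close> have "d2_matrix p m (X 1) b c = 0"
      using d2 by blast
    ultimately show "pullback_ad_X1 p (\<lambda>h. m h c) b = (-1) ^ (parity b * parity c) * pullback_ad_X1 p (\<lambda>h. m h b) c"
      using \<open>X 1 \<in> gens p\<close>
      by (simp add: d2_matrix_def sum_basis_bracket_mult[OF p] del: pullback_ad_X1.simps X_in_gens)
  qed
qed

text \<open>After splitting \<open>x\<close>, \<open>y\<close>, \<open>z\<close> into homogeneous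
  parts, a basis triple contributes only to the summand whose parities are its own, and there the
  signs of \<open>d2_homogeneous\<close> are those of \<open>d2_matrix\<close>.\<close>

lemma cochain_d2_bilinear_cochain:
  assumes "x \<in> vecs p" "y \<in> vecs p" "z \<in> vecs p"
  shows "cochain_d2 (model_filiform p lam) (bilinear_cochain p m) [x, y, z]
    = (\<Sum>a\<in>gens p. \<Sum>b\<in>gens p. \<Sum>c\<in>gens p. x a * y b * z c * d2_matrix p m a b c)"
proof -
  let ?L = "model_filiform p lam" and ?G = "gens p"
  let ?B = "\<lambda>a b c. \<Sum>h\<in>?G. basis_bracket p a b h * m h c"
  have bracket: "bilinear_cochain p m [bracket ?L u v, w]
      = (\<Sum>a\<in>?G. \<Sum>b\<in>?G. \<Sum>c\<in>?G. u a * v b * w c * ?B a b c)"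
    if w: "w \<in> vecs p" for u v w
  proof -
    have "bilinear_cochain p m [bracket ?L u v, w]
        = (\<Sum>h\<in>?G. bracket ?L u v h * (\<Sum>c\<in>?G. w c * m h c))"
      unfolding bilinear_cochain_pair[OF bracket_in_vecs w] by (simp add: sum_distrib_left mult.assoc)
    also have "\<dots> = (\<Sum>a\<in>?G. \<Sum>b\<in>?G. u a * v b * (\<Sum>h\<in>?G. basis_bracket p a b h * (\<Sum>c\<in>?G. w c * m h c)))"
      by (rule sum_bracket_mult)
    also have "\<dots> = (\<Sum>a\<in>?G. \<Sum>b\<in>?G. \<Sum>c\<in>?G. u a * v b * w c * ?B a b c)"
    proof (intro sum.cong refl)
      fix a b
      have "(\<Sum>h\<in>?G. basis_bracket p a b h * (\<Sum>c\<in>?G. w c * m h c))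
          = (\<Sum>h\<in>?G. \<Sum>c\<in>?G. w c * (basis_bracket p a b h * m h c))"
        by (simp add: sum_distrib_left ac_simps)
      also have "\<dots> = (\<Sum>c\<in>?G. \<Sum>h\<in>?G. w c * (basis_bracket p a b h * m h c))"
        by (rule sum.swap)
      finally show "u a * v b * (\<Sum>h\<in>?G. basis_bracket p a b h * (\<Sum>c\<in>?G. w c * m h c))
          = (\<Sum>c\<in>?G. u a * v b * w c * ?B a b c)"
        by (simp add: sum_distrib_left mult.assoc)
    qed
    finally show ?thesis .
  qed
  have hom: "d2_homogeneous ?L (bilinear_cochain p m) i j k u v w
      = (\<Sum>a\<in>?G. \<Sum>b\<in>?G. \<Sum>c\<in>?G. u a * v b * w c * (- ?B a b c
          + (-1) ^ (j * k) * ?B a c b - (-1) ^ (i * (j + k)) * ?B b c a))"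
    if "u \<in> vecs p" "v \<in> vecs p" "w \<in> vecs p" for i j k u v w
  proof -
    \<comment> \<open>All three terms are brought to the common coefficient
      \<open>u a * v b * w c\<close> so that they can be added.\<close>
    have 1: "bilinear_cochain p m [bracket ?L u w, v]
        = (\<Sum>a\<in>?G. \<Sum>b\<in>?G. \<Sum>c\<in>?G. u a * v b * w c * ?B a c b)"
      unfolding bracket[OF that(2)] by (rule sum.cong[OF refl], subst sum.swap) (simp add: ac_simps)
    have "bilinear_cochain p m [bracket ?L v w, u]
        = (\<Sum>b\<in>?G. \<Sum>c\<in>?G. \<Sum>a\<in>?G. v b * w c * u a * ?B b c a)"
      by (rule bracket[OF that(1)])
    also have "\<dots> = (\<Sum>b\<in>?G. \<Sum>a\<in>?G. \<Sum>c\<in>?G. v b * w c * u a * ?B b c a)"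
      by (intro sum.cong[OF refl] sum.swap)
    also have "\<dots> = (\<Sum>a\<in>?G. \<Sum>b\<in>?G. \<Sum>c\<in>?G. v b * w c * u a * ?B b c a)"
      by (rule sum.swap)
    finally have 2: "bilinear_cochain p m [bracket ?L v w, u]
        = (\<Sum>a\<in>?G. \<Sum>b\<in>?G. \<Sum>c\<in>?G. u a * v b * w c * ?B b c a)"
      by (simp add: ac_simps)
    show ?thesis
      unfolding d2_homogeneous_def bracket[OF that(3)] 1 2
      by (simp add: distrib_left right_diff_distrib sum.distrib sum_subtractf sum_negf sum_distrib_left
          mult.left_commute)
  qed
  define pr where "pr = (\<lambda>(i::nat) (v :: gen \<Rightarrow> 'a) g. if parity g = i mod 2 then v g else 0)"
  have pr: "pr i v \<in> vecs p" "hom_comp ?L i v = pr i v" if "v \<in> vecs p" for i v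
    using that by (simp_all add: pr_def vecs_def hom_comp_model_filiform[unfolded vecs_def])
  have "cochain_d2 ?L (bilinear_cochain p m) [x, y, z]
      = (\<Sum>i<2. \<Sum>j<2. \<Sum>k<2. \<Sum>a\<in>?G. \<Sum>b\<in>?G. \<Sum>c\<in>?G. pr i x a * pr j y b * pr k z c * (- ?B a b c
          + (-1) ^ (j * k) * ?B a c b - (-1) ^ (i * (j + k)) * ?B b c a))"
    using assms by (simp add: cochain_d2_def pr hom numeral_2_eq_2 del: model_filiform_simps(4))
  also have "\<dots> = (\<Sum>a\<in>?G. \<Sum>b\<in>?G. \<Sum>c\<in>?G. \<Sum>i<2. \<Sum>j<2. \<Sum>k<2. pr i x a * pr j y b * pr k z c * (- ?B a b c
          + (-1) ^ (j * k) * ?B a c b - (-1) ^ (i * (j + k)) * ?B b c a))"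
    by (simp add: numeral_2_eq_2 sum.distrib)
  also have "\<dots> = (\<Sum>a\<in>?G. \<Sum>b\<in>?G. \<Sum>c\<in>?G. x a * y b * z c * d2_matrix p m a b c)"
  proof (intro sum.cong refl)
    fix a b c
    show "(\<Sum>i<2. \<Sum>j<2. \<Sum>k<2. pr i x a * pr j y b * pr k z c * (- ?B a b c
          + (-1) ^ (j * k) * ?B a c b - (-1) ^ (i * (j + k)) * ?B b c a)) = x a * y b * z c * d2_matrix p m a b c"
      unfolding d2_matrix_def pr_def
      by (cases a; cases b; cases c) (simp_all add: numeral_2_eq_2)
  qed
  finally show ?thesis .
qed

text \<open>By the preceding lemma d^2 is the trilinear form with coefficients
  \<open>d2_matrix\<close>; evaluation at basis vectors recovers each coefficient.\<close>

lemma cocycles2_model_filiform: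
  fixes lam :: "nat \<Rightarrow> 'a::field"
  assumes p: "p > 0"
  shows "cocycles2 (model_filiform p lam) =
    bilinear_cochain p ` {m. supersymmetric p m \<and> closed_matrix p m}"
proof (intro equalityI subsetI)
  let ?L = "model_filiform p lam"
  fix \<alpha> assume "\<alpha> \<in> cocycles2 ?L"
  then have \<alpha>: "\<alpha> \<in> cochains ?L 2" and d2: "cochain_d2 ?L \<alpha> xs = 0" for xs
    by (auto simp: cocycles2_def)
  define m where "m = (\<lambda>a b. \<alpha> [basis_vec a, basis_vec b])"
  note m = cochain2_eq_bilinear_cochain[OF \<alpha>, folded m_def]
  have "d2_matrix p m a b c = 0" if "a \<in> gens p" "b \<in> gens p" "c \<in> gens p" for a b c
  proof -
    have "0 = cochain_d2 ?L (bilinear_cochain p m) [basis_vec a, basis_vec b, basis_vec c]"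
      using d2 m(1) by simp
    also have "\<dots> = d2_matrix p m a b c"
      using that by (simp add: cochain_d2_bilinear_cochain mult.assoc flip: sum_distrib_left)
    finally show ?thesis by simp
  qed
  with m p show "\<alpha> \<in> bilinear_cochain p ` {m. supersymmetric p m \<and> closed_matrix p m}"
    by (auto simp: closed_matrix_iff_d2_matrix)
next
  let ?L = "model_filiform p lam"
  fix \<alpha> assume "\<alpha> \<in> bilinear_cochain p ` {m :: gen \<Rightarrow> gen \<Rightarrow> 'a. supersymmetric p m \<and> closed_matrix p m}"
  then obtain m where \<alpha>: "\<alpha> = bilinear_cochain p m" and m: "supersymmetric p m" "closed_matrix p m"
    by blast
  have "cochain_d2 ?L \<alpha> xs = 0" for xs
  proof (cases "length xs = 3 \<and> set xs \<subseteq> vecs p")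
    case True
    then obtain x y z where xs: "xs = [x, y, z]" "x \<in> vecs p" "y \<in> vecs p" "z \<in> vecs p"
      by (auto simp: numeral_3_eq_3 length_Suc_conv)
    then show ?thesis
      using m(2) by (simp add: \<alpha> cochain_d2_bilinear_cochain closed_matrix_iff_d2_matrix[OF p])
  next
    case False
    then show ?thesis by (auto simp: cochain_d2_def)
  qed
  then show "\<alpha> \<in> cocycles2 ?L"
    using bilinear_cochain_in_cochains[OF m(1)] by (auto simp: cocycles2_def \<alpha>)
qed

section \<open>The vector space of cocycles\<close>

lemma supersymmetric_add:
  "supersymmetric p m \<Longrightarrow> supersymmetric p m' \<Longrightarrow> supersymmetric p (\<lambda>a b. m a b + m' a b)"
  unfolding supersymmetric_def by (auto simp: ring_distribs) (metis add.assoc add.left_commute add.right_neutral)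

lemma supersymmetric_smult:
  fixes c :: "'a::field"
  shows "supersymmetric p m \<Longrightarrow> supersymmetric p (\<lambda>a b. c * m a b)"
  unfolding supersymmetric_def
  by (metis (no_types, lifting) distrib_left mult.left_commute mult_zero_right)

lemma pullback_ad_X1_add: "pullback_ad_X1 p (\<lambda>h. f h + g h) b = (pullback_ad_X1 p f b + pullback_ad_X1 p g b :: 'a::field)"
  by (cases b) auto

lemma pullback_ad_X1_smult: "pullback_ad_X1 p (\<lambda>h. c * f h) b = (c * pullback_ad_X1 p f b :: 'a::field)"
  by (cases b) auto

lemma closed_matrix_add:
  "closed_matrix p m \<Longrightarrow> closed_matrix p m' \<Longrightarrow> closed_matrix p (\<lambda>a b. m a b + m' a b)"
  unfolding closed_matrix_def pullback_ad_X1_add distrib_left by metis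

lemma closed_matrix_smult:
  "closed_matrix p m \<Longrightarrow> closed_matrix p (\<lambda>a b. c * m a b)"
  unfolding closed_matrix_def pullback_ad_X1_smult by (metis mult.left_commute)

lemma cocycle_space_simps:
  "carrier (cocycle_space L) = cocycles2 L"
  "\<zero>\<^bsub>cocycle_space L\<^esub> = (\<lambda>_. 0)"
  "x \<oplus>\<^bsub>cocycle_space L\<^esub> y = (\<lambda>xs. x xs + y xs)"
  "c \<odot>\<^bsub>cocycle_space L\<^esub> x = (\<lambda>xs. c * x xs)"
  by (simp_all add: cocycle_space_def)

text \<open>Closure is checked on matrices, where both conditions are linear; the remaining axioms
  hold pointwise.\<close>

lemma vectorspace_cocycle_space:
  fixes lam :: "nat \<Rightarrow> 'a::field"
  assumes p: "p > 0"
  shows "vectorspace class_ring (cocycle_space (model_filiform p lam))"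
proof -
  let ?Z = "cocycles2 (model_filiform p lam)"
  have add: "(\<lambda>xs. x xs + y xs) \<in> ?Z" if xy: "x \<in> ?Z" "y \<in> ?Z" for x y
  proof -
    obtain m m' where "x = bilinear_cochain p m" "supersymmetric p m" "closed_matrix p m"
      "y = bilinear_cochain p m'" "supersymmetric p m'" "closed_matrix p m'"
      using xy unfolding cocycles2_model_filiform[OF p] by blast
    then show ?thesis
      unfolding cocycles2_model_filiform[OF p]
      by (intro image_eqI[of _ _ "\<lambda>a b. m a b + m' a b"])
        (simp_all add: bilinear_cochain_add supersymmetric_add closed_matrix_add)
  qed
  have smult: "(\<lambda>xs. c * x xs) \<in> ?Z" if x: "x \<in> ?Z" for c x
  proof -
    obtain m where "x = bilinear_cochain p m" "supersymmetric p m" "closed_matrix p m"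
      using x unfolding cocycles2_model_filiform[OF p] by blast
    then show ?thesis
      unfolding cocycles2_model_filiform[OF p]
      by (intro image_eqI[of _ _ "\<lambda>a b. c * m a b"])
        (simp_all add: bilinear_cochain_smult supersymmetric_smult closed_matrix_smult)
  qed
  have zero: "(\<lambda>_. 0) \<in> ?Z"
    unfolding cocycles2_model_filiform[OF p]
    by (intro image_eqI[of _ _ "\<lambda>_ _. 0"])
      (auto simp: bilinear_cochain_zero supersymmetric_def closed_matrix_def gens_def)
  have "abelian_group (cocycle_space (model_filiform p lam))"
  proof (rule abelian_groupI; simp only: cocycle_space_simps)
    fix x assume "x \<in> ?Z"
    then show "\<exists>y\<in>?Z. (\<lambda>xs. y xs + x xs) = (\<lambda>_. 0)"
      using smult[of x "-1"] by (intro bexI[of _ "\<lambda>xs. - 1 * x xs"]) auto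
  qed (auto simp: add zero ac_simps)
  then have "Module.module class_ring (cocycle_space (model_filiform p lam))"
    by (intro moduleI class_cring.is_cring) (auto simp: cocycle_space_simps smult ring_distribs mult.assoc)
  then show ?thesis
    by (intro vectorspace.intro class_field)
qed

section \<open>The distinguished cocycles as matrices\<close>

text \<open>The summation ranges of the paper list each pair of arguments once; as matrices, with both orders of
  the arguments, \<^const>\<open>phi_XX\<close>, \<^const>\<open>psi_XY\<close> and \<^const>\<open>phi_YY\<close> have the uniform entries below because
  \<open>i\<close> is odd and \<open>k\<close> is even.\<close>

fun alt_XX :: "nat \<Rightarrow> gen \<Rightarrow> gen \<Rightarrow> 'a::field" where
  "alt_XX i (X r) (X s) = (if 2 \<le> r \<and> 2 \<le> s \<and> r + s = i then (-1) ^ r else 0)"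
| "alt_XX i _ _ = 0"

fun alt_XY :: "nat \<Rightarrow> gen \<Rightarrow> gen \<Rightarrow> 'a::field" where
  "alt_XY j (X s) (Y t) = (if 2 \<le> s \<and> 1 \<le> t \<and> s + t = j + 1 then (-1) ^ s else 0)"
| "alt_XY j (Y t) (X s) = (if 2 \<le> s \<and> 1 \<le> t \<and> s + t = j + 1 then - ((-1) ^ s) else 0)"
| "alt_XY j _ _ = 0"

fun alt_YY :: "nat \<Rightarrow> gen \<Rightarrow> gen \<Rightarrow> 'a::field" where
  "alt_YY k (Y s) (Y t) = (if 1 \<le> s \<and> 1 \<le> t \<and> s + t = k then (-1) ^ s else 0)"
| "alt_YY k _ _ = 0"

lemma minus_one_power_parity:
  "even (r + s) \<Longrightarrow> (-1 :: 'a::field) ^ r = (-1) ^ s"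
  "odd (r + s) \<Longrightarrow> (-1 :: 'a::field) ^ r = - ((-1) ^ s)"
  by (auto simp: minus_one_power_iff)

text \<open>For odd \<open>i\<close> the range up to \<open>i div 2\<close> contains exactly the
  smaller member of each pair with sum \<open>i\<close>. Reversed arguments give the negative entry,
  which is again the uniform one since (-1)^r and (-1)^s differ in sign when r + s is odd.\<close>

lemma phi_XX_eq_bilinear_cochain:
  assumes "odd i"
  shows "phi_XX p i = bilinear_cochain p (alt_XX i)"
proof -
  have "(\<Sum>k=2..i div 2. (-1) ^ k * (if a = X k \<and> b = X (i - k) then 1
      else if a = X (i - k) \<and> b = X k then -1 else 0)) = (alt_XX i a b :: 'a)" (is "?S = _") for a b
  proof (cases "\<exists>r s. a = X r \<and> b = X s \<and> 2 \<le> r \<and> 2 \<le> s \<and> r + s = i")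
    case True
    then obtain r s where rs: "a = X r" "b = X s" "2 \<le> r" "2 \<le> s" "r + s = i" by blast
    show ?thesis
    proof (cases "r < s")
      case True
      have "?S = (\<Sum>k=2..i div 2. if k = r then (-1) ^ k else 0)"
        using rs True by (intro sum.cong) auto
      then show ?thesis using rs True by auto
    next
      case False
      then have "s < r" using rs assms by (cases "r = s") auto
      have "?S = (\<Sum>k=2..i div 2. if k = s then - ((-1) ^ k) else 0)"
        using rs \<open>s < r\<close> by (intro sum.cong) auto
      moreover have "(-1 :: 'a) ^ r = - ((-1) ^ s)"
        using rs assms by (intro minus_one_power_parity) simp
      ultimately show ?thesis using rs \<open>s < r\<close> by auto
    qed
  next
    case False
    then have "alt_XX i a b = (0 :: 'a)"
      by (cases a; cases b) auto
    moreover have "?S = 0"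
      using False by (intro sum.neutral) auto
    ultimately show ?thesis by simp
  qed
  then show ?thesis
    unfolding phi_XX_def XX_def bilinear_cochain_sum by (intro ext) simp
qed

lemma psi_XY_eq_bilinear_cochain: "psi_XY p j = bilinear_cochain p (alt_XY j)"
proof -
  have "(\<Sum>k=2..j. (-1) ^ k * (if a = X k \<and> b = Y (j + 1 - k) then 1
      else if a = Y (j + 1 - k) \<and> b = X k then -1 else 0)) = (alt_XY j a b :: 'a)" (is "?S = _") for a b
  proof (cases "\<exists>s t. (a = X s \<and> b = Y t \<or> a = Y t \<and> b = X s) \<and> 2 \<le> s \<and> 1 \<le> t \<and> s + t = j + 1")
    case True
    then obtain s t where st: "a = X s \<and> b = Y t \<or> a = Y t \<and> b = X s" "2 \<le> s" "1 \<le> t" "s + t = j + 1"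
      by blast
    have "?S = (\<Sum>k=2..j. if k = s then (if a = X s then (-1) ^ k else - ((-1) ^ k)) else 0)"
      using st by (intro sum.cong) auto
    then show ?thesis using st by auto
  next
    case False
    then have "alt_XY j a b = (0 :: 'a)"
      by (cases a; cases b) auto
    \<comment> \<open>For \<open>k\<close> in the range the truncated subtraction is exact, so such
      an entry would be one of the pairs excluded here.\<close>
    moreover have "\<not> (a = X k \<and> b = Y (j + 1 - k)) \<and> \<not> (a = Y (j + 1 - k) \<and> b = X k)"
      if "k \<in> {2..j}" for k
    proof -
      have "2 \<le> k" "1 \<le> j + 1 - k" "k + (j + 1 - k) = j + 1"
        using that by auto
      with False show ?thesis by blast
    qed
    then have "?S = 0"
      by (intro sum.neutral) auto
    ultimately show ?thesis by simp
  qed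
  then show ?thesis
    unfolding psi_XY_def XY_def bilinear_cochain_sum by (intro ext) simp
qed

text \<open>The sum covers the off-diagonal pairs through their smaller member. The last term covers
  the diagonal, where \<open>YY\<close> takes the value 2 and the factor 1/2 normalizes it.\<close>

lemma phi_YY_eq_bilinear_cochain:
  assumes k: "even k" "2 \<le> k" and two: "(2 :: 'a::field) \<noteq> 0"
  shows "phi_YY p k = (bilinear_cochain p (alt_YY k) :: (gen \<Rightarrow> 'a) list \<Rightarrow> 'a)"
proof -
  have "(\<Sum>u=1..k div 2 - 1. (-1) ^ u * (if a = Y u \<and> b = Y (k - u) \<or> a = Y (k - u) \<and> b = Y u
        then if u = k - u then 2 else 1 else 0))
      + (-1) ^ (k div 2) * (1 / 2) * (if a = Y (k div 2) \<and> b = Y (k div 2) \<or>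
          a = Y (k div 2) \<and> b = Y (k div 2) then if k div 2 = k div 2 then 2 else 1 else 0)
      = (alt_YY k a b :: 'a)" (is "?S + ?M = _") for a b
  proof (cases "\<exists>s t. a = Y s \<and> b = Y t \<and> 1 \<le> s \<and> 1 \<le> t \<and> s + t = k")
    case True
    then obtain s t where st: "a = Y s" "b = Y t" "1 \<le> s" "1 \<le> t" "s + t = k" by blast
    have eq: "(-1 :: 'a) ^ s = (-1) ^ t"
      using st k by (intro minus_one_power_parity) simp
    show ?thesis
    proof (cases "s = t")
      case True
      then have "?S = 0" using st by (intro sum.neutral) auto
      then show ?thesis using True st two by auto
    next
      case False
      have "?S = (\<Sum>u=1..k div 2 - 1. if u = min s t then (-1) ^ u else 0)"
        using False st by (intro sum.cong) (auto simp: min_def)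
      also have "\<dots> = (-1) ^ min s t"
        using False st k by (auto simp: min_def)
      also have "\<dots> = (-1) ^ s"
        using eq by (auto simp: min_def)
      moreover have "?M = 0" using False st by auto
      ultimately show ?thesis using st by simp
    qed
  next
    case False
    then have "alt_YY k a b = (0 :: 'a)"
      by (cases a; cases b) auto
    moreover have "?S = 0"
      using False by (intro sum.neutral) auto
    moreover have "1 \<le> k div 2" "k div 2 + k div 2 = k"
      using k by (simp_all add: div_greater_zero_iff Suc_le_eq flip: mult_2)
    then have "\<not> (a = Y (k div 2) \<and> b = Y (k div 2))"
      using False by blast
    then have "?M = 0" by auto
    ultimately show ?thesis by simp
  qed
  then show ?thesis
    unfolding phi_YY_def YY_def bilinear_cochain_sum
    unfolding bilinear_cochain_smult bilinear_cochain_add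
    by (intro ext) simp
qed

section \<open>Coordinates dual to the distinguished cocycles\<close>

text \<open>Each distinguished cocycle is indexed by the entry of its matrix that is \<open>\<plusminus>1\<close> and at which all the others
  vanish.\<close>

fun index_cochain :: "nat \<Rightarrow> gen \<times> gen \<Rightarrow> (gen \<Rightarrow> 'a::field) list \<Rightarrow> 'a" where
  "index_cochain p (X i, X j) = (if i = 1 then XX p 1 j else phi_XX p (j + 2))"
| "index_cochain p (X i, Y j) = (if i = 1 then XY p 1 j else psi_XY p (j + 1))"
| "index_cochain p (Y i, b) = (case b of X j \<Rightarrow> \<lambda>_. 0 | Y j \<Rightarrow> phi_YY p (j + 1))"

text \<open>As \<open>X 1\<close> is even, X^{1,j} and X^1 Y^l have the same antisymmetric shape and
  are treated together.\<close>

definition X1_wedge :: "gen \<Rightarrow> gen \<Rightarrow> gen \<Rightarrow> 'a::field" where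
  "X1_wedge g = (\<lambda>a b. if a = X 1 \<and> b = g then 1 else if a = g \<and> b = X 1 then -1 else 0)"

text \<open>The shifts select the antidiagonal through the given entry: the index sum is j + 2 at (X
  2, X j) and at (X 2, Y j), where \<open>alt_XY\<close> itself adds 1, and j + 1 at (Y 1, Y
  j).\<close>

fun index_matrix :: "gen \<times> gen \<Rightarrow> gen \<Rightarrow> gen \<Rightarrow> 'a::field" where
  "index_matrix (X i, X j) = (if i = 1 then X1_wedge (X j) else alt_XX (j + 2))"
| "index_matrix (X i, Y j) = (if i = 1 then X1_wedge (Y j) else alt_XY (j + 1))"
| "index_matrix (Y i, b) = (case b of X j \<Rightarrow> \<lambda>_ _. 0 | Y j \<Rightarrow> alt_YY (j + 1))"

definition index_set :: "nat \<Rightarrow> (gen \<times> gen) set" where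
  "index_set p = {(X 1, X p), (X 1, Y p)} \<union> (\<lambda>k. (X 2, X (2 * k + 1))) ` {1..p div 2}
     \<union> (\<lambda>j. (X 2, Y j)) ` {1..<p} \<union> (\<lambda>k. (Y 1, Y (2 * k + 1))) ` {0..p div 2}"

text \<open>The alternating signs are (-1)^2 in row \<open>X 2\<close> but (-1)^1 in row
  \<open>Y 1\<close>; the factor makes the forms exactly dual.\<close>

fun coordinate :: "gen \<times> gen \<Rightarrow> ((gen \<Rightarrow> 'a::field) list \<Rightarrow> 'a) \<Rightarrow> 'a" where
  "coordinate (a, b) \<alpha> = (if a = Y 1 then -1 else 1) * \<alpha> [basis_vec a, basis_vec b]"

lemma finite_index_set: "finite (index_set p)"
  by (simp add: index_set_def)

lemma index_set_subset: "odd p \<Longrightarrow> p > 2 \<Longrightarrow> index_set p \<subseteq> gens p \<times> gens p"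
  by (auto simp: index_set_def elim!: oddE)

text \<open>With p = 2h + 1 the blocks contribute 2, h, 2h and h + 1, in total 4h + 3 = 2p +
  1.\<close>

lemma card_index_set:
  assumes "odd p" "p > 2"
  shows "card (index_set p) = 2 * p + 1"
proof -
  let ?A = "{(X 1, X p), (X 1, Y p)}" and ?B = "(\<lambda>k. (X 2, X (2 * k + 1))) ` {1..p div 2}"
    and ?C = "(\<lambda>j. (X 2, Y j)) ` {1..<p}" and ?D = "(\<lambda>k. (Y 1, Y (2 * k + 1))) ` {0..p div 2}"
  have "card ?A = 2" by simp
  moreover have "card ?B = p div 2" "card ?C = p - 1" "card ?D = p div 2 + 1"
    by (subst card_image; simp add: inj_on_def)+
  moreover have "card (?A \<union> ?B) = card ?A + card ?B"
    by (rule card_Un_disjoint) auto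
  moreover have "card (?A \<union> ?B \<union> ?C) = card (?A \<union> ?B) + card ?C"
    by (rule card_Un_disjoint) auto
  moreover have "card (?A \<union> ?B \<union> ?C \<union> ?D) = card (?A \<union> ?B \<union> ?C) + card ?D"
    by (rule card_Un_disjoint) auto
  moreover have "p = 2 * (p div 2) + 1"
    using assms by simp
  ultimately show ?thesis
    unfolding index_set_def by linarith
qed

lemma Omega4_eq_image_index_cochain:
  assumes "odd p" "p > 2"
  shows "Omega4 p = index_cochain p ` index_set p"
proof -
  have 1: "{i. odd i \<and> 5 \<le> i \<and> i \<le> p + 2} = (\<lambda>k. 2 * k + 3) ` {1..p div 2}"
  proof (intro equalityI subsetI)
    fix i assume "i \<in> {i. odd i \<and> 5 \<le> i \<and> i \<le> p + 2}"
    then have "i = 2 * ((i - 3) div 2) + 3" "(i - 3) div 2 \<in> {1..p div 2}"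
      by (auto elim!: oddE)
    then show "i \<in> (\<lambda>k. 2 * k + 3) ` {1..p div 2}" by blast
  qed (use assms in \<open>auto elim!: oddE\<close>)
  have 2: "{2..p} = Suc ` {1..<p}"
    by (simp add: atLeastLessThanSuc_atLeastAtMost numeral_2_eq_2)
  have 3: "{k. even k \<and> 2 \<le> k \<and> k \<le> p + 1} = (\<lambda>k. 2 * k + 2) ` {0..p div 2}"
  proof (intro equalityI subsetI)
    fix k assume "k \<in> {k. even k \<and> 2 \<le> k \<and> k \<le> p + 1}"
    then have "k = 2 * ((k - 2) div 2) + 2" "(k - 2) div 2 \<in> {0..p div 2}"
      by (auto elim!: evenE)
    then show "k \<in> (\<lambda>k. 2 * k + 2) ` {0..p div 2}" by blast
  qed (use assms in \<open>auto elim!: oddE\<close>)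
  show ?thesis
    unfolding Omega4_def index_set_def 1 2 3 image_Un image_image
    by (simp add: numeral_3_eq_3 numeral_2_eq_2)
qed

lemma index_cochain_eq_bilinear_cochain:
  assumes "odd p" "(2 :: 'a::field) \<noteq> 0" "q \<in> index_set p"
  shows "index_cochain p q = (bilinear_cochain p (index_matrix q) :: (gen \<Rightarrow> 'a) list \<Rightarrow> 'a)"
  using assms
  by (auto simp: index_set_def XX_def XY_def X1_wedge_def phi_XX_eq_bilinear_cochain psi_XY_eq_bilinear_cochain
      phi_YY_eq_bilinear_cochain cong: if_cong)

lemma supersymmetric_index_matrix:
  assumes "p > 2" "q \<in> index_set p"
  shows "supersymmetric p (index_matrix q :: gen \<Rightarrow> gen \<Rightarrow> 'a::field)"
proof -
  have XX: "supersymmetric p (alt_XX i :: gen \<Rightarrow> gen \<Rightarrow> 'a)" if "odd i" for i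
    unfolding supersymmetric_def
  proof (intro ballI)
    fix a b show "alt_XX i a b + (-1) ^ (parity a * parity b) * alt_XX i b a = (0 :: 'a)"
      using that by (cases a; cases b) (auto simp: minus_one_power_iff)
  qed
  have XY: "supersymmetric p (alt_XY j :: gen \<Rightarrow> gen \<Rightarrow> 'a)" for j
    unfolding supersymmetric_def
  proof (intro ballI)
    fix a b show "alt_XY j a b + (-1) ^ (parity a * parity b) * alt_XY j b a = (0 :: 'a)"
      by (cases a; cases b) auto
  qed
  have YY: "supersymmetric p (alt_YY k :: gen \<Rightarrow> gen \<Rightarrow> 'a)" if "even k" for k
    unfolding supersymmetric_def
  proof (intro ballI)
    fix a b show "alt_YY k a b + (-1) ^ (parity a * parity b) * alt_YY k b a = (0 :: 'a)"
      using that by (cases a; cases b) (auto simp: minus_one_power_iff)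
  qed
  have "supersymmetric p (X1_wedge (X p) :: gen \<Rightarrow> gen \<Rightarrow> 'a)" "supersymmetric p (X1_wedge (Y p) :: gen \<Rightarrow> gen \<Rightarrow> 'a)"
    using assms(1) unfolding supersymmetric_def by (auto simp: X1_wedge_def)
  then show ?thesis
    using assms XX XY YY by (auto simp: index_set_def)
qed

text \<open>Along an antidiagonal the signs alternate, which is the recurrence. The upper bounds on
  \<open>i\<close>, \<open>j\<close>, \<open>k\<close> serve the cut-off: where one side is 0
  because an index equals \<open>p\<close>, the entry on the other side lies beyond the
  antidiagonal. For \<open>X1_wedge\<close> both sides vanish, since ad X_1 never produces
  \<open>X 1\<close>.\<close>

lemma closed_index_matrix:
  assumes "odd p" "q \<in> index_set p"
  shows "closed_matrix p (index_matrix q :: gen \<Rightarrow> gen \<Rightarrow> 'a::field)"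
proof -
  have XX: "closed_matrix p (alt_XX i :: gen \<Rightarrow> gen \<Rightarrow> 'a)" if "odd i" "i \<le> p + 2" for i
    unfolding closed_matrix_def
  proof (intro ballI)
    fix b c assume "b \<in> gens p - {X 1}" "c \<in> gens p - {X 1}"
    with that show "pullback_ad_X1 p (\<lambda>h. alt_XX i h c) b = (-1) ^ (parity b * parity c) * (pullback_ad_X1 p (\<lambda>h. alt_XX i h b) c :: 'a)"
      by (cases b; cases c) (auto simp: minus_one_power_iff)
  qed
  have XY: "closed_matrix p (alt_XY j :: gen \<Rightarrow> gen \<Rightarrow> 'a)" if "j \<le> p" for j
    unfolding closed_matrix_def
  proof (intro ballI)
    fix b c assume "b \<in> gens p - {X 1}" "c \<in> gens p - {X 1}"
    with that show "pullback_ad_X1 p (\<lambda>h. alt_XY j h c) b = (-1) ^ (parity b * parity c) * (pullback_ad_X1 p (\<lambda>h. alt_XY j h b) c :: 'a)"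
      by (cases b; cases c) auto
  qed
  have YY: "closed_matrix p (alt_YY k :: gen \<Rightarrow> gen \<Rightarrow> 'a)" if "even k" "k \<le> p + 1" for k
    unfolding closed_matrix_def
  proof (intro ballI)
    fix b c assume "b \<in> gens p - {X 1}" "c \<in> gens p - {X 1}"
    with that show "pullback_ad_X1 p (\<lambda>h. alt_YY k h c) b = (-1) ^ (parity b * parity c) * (pullback_ad_X1 p (\<lambda>h. alt_YY k h b) c :: 'a)"
      by (cases b; cases c) (auto simp: minus_one_power_iff)
  qed
  have X1: "closed_matrix p (X1_wedge g :: gen \<Rightarrow> gen \<Rightarrow> 'a)" for g
    unfolding closed_matrix_def
  proof (intro ballI)
    fix b c assume "b \<in> gens p - {X 1}" "c \<in> gens p - {X 1}"
    then show "pullback_ad_X1 p (\<lambda>h. X1_wedge g h c) b = (-1) ^ (parity b * parity c) * (pullback_ad_X1 p (\<lambda>h. X1_wedge g h b) c :: 'a)"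
      by (cases b; cases c) (auto simp: X1_wedge_def)
  qed
  show ?thesis
    using assms XX XY YY X1 by (auto simp: index_set_def elim!: oddE)
qed

text \<open>Each matrix is supported on one antidiagonal of a block and its transpose, or on one
  entry in the row of \<open>X 1\<close> and its transpose; this support meets
  \<open>index_set p\<close> exactly once.\<close>

lemma coordinate_index_cochain:
  assumes "odd p" "p > 2" "(2 :: 'a::field) \<noteq> 0" "q \<in> index_set p" "q' \<in> index_set p"
  shows "coordinate q (index_cochain p q') = (if q = q' then 1 else (0 :: 'a))"
proof -
  obtain a b where q: "q = (a, b)" by (cases q)
  have ab: "a \<in> gens p" "b \<in> gens p"
    using index_set_subset[OF assms(1,2)] assms(4) by (auto simp: q)
  have "coordinate q (index_cochain p q') = (if a = Y 1 then -1 else 1) * (index_matrix q' a b :: 'a)"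
    using ab by (simp add: q index_cochain_eq_bilinear_cochain[OF assms(1,3,5)])
  also have "\<dots> = (if q = q' then 1 else 0)"
    using assms unfolding index_set_def q by (auto simp: X1_wedge_def split: if_splits)
  finally show ?thesis .
qed

section \<open>Cocycles with vanishing coordinates\<close>

text \<open>Every step along the antidiagonal contributes -1. In a square block this relates an
  entry of the first row to its transpose.\<close>

lemma grid_path:
  fixes f :: "nat \<Rightarrow> nat \<Rightarrow> 'a::field"
  assumes "\<And>i j. u \<le> i \<Longrightarrow> i < p \<Longrightarrow> v \<le> j \<Longrightarrow> j < p \<Longrightarrow> f (Suc i) j = - f i (Suc j)"
    and "u + k \<le> p" "v \<le> w" "w + k \<le> p"
  shows "f (u + k) w = (-1) ^ k * f u (w + k)"
  using assms(2-)
proof (induction k arbitrary: w)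
  case (Suc k)
  then have "f (u + Suc k) w = - f (u + k) (Suc w)"
    using assms(1)[of "u + k" w] by simp
  with Suc show ?case by simp
qed simp

lemma grid_zero:
  fixes f :: "nat \<Rightarrow> nat \<Rightarrow> 'a::field"
  assumes step: "\<And>i j. u \<le> i \<Longrightarrow> i < p \<Longrightarrow> v \<le> j \<Longrightarrow> j \<le> p \<Longrightarrow> f (Suc i) j = (if j < p then - f i (Suc j) else 0)"
    and row: "\<And>j. v \<le> j \<Longrightarrow> j \<le> p \<Longrightarrow> f u j = 0"
    and "u \<le> i" "i \<le> p" "v \<le> j" "j \<le> p"
  shows "f i j = 0"
  using assms(3-)
proof (induction i arbitrary: j rule: dec_induct)
  case base
  then show ?case using row by simp
next
  case (step i)
  then show ?case using assms(1)[of i j] by auto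
qed

text \<open>By \<open>grid_zero\<close> it suffices that the first row of each block vanishes. The
  entries of that row outside \<open>index_set p\<close> are handled by comparing the recurrence
  with the symmetry of the block or with the cut-off at \<open>p\<close>.\<close>

lemma matrix_eq_0_off_X1:
  fixes m :: "gen \<Rightarrow> gen \<Rightarrow> 'a::field"
  assumes p: "odd p" "p > 2" and two: "(2 :: 'a) \<noteq> 0"
    and m: "supersymmetric p m" "closed_matrix p m"
    and zero: "\<And>a b. (a, b) \<in> index_set p \<Longrightarrow> m a b = 0"
    and ab: "a \<in> gens p - {X 1}" "b \<in> gens p - {X 1}"
  shows "m a b = 0"
proof -
  have eq_neg_imp_0: "x = 0" if "x = - x" for x :: 'a
    using that two by (metis add.right_inverse mult_2 mult_eq_0_iff)
  have sym: "m a b + (-1) ^ (parity a * parity b) * m b a = 0" if "a \<in> gens p" "b \<in> gens p" for a b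
    using m(1) that unfolding supersymmetric_def by blast
  have sym_XX: "m (X s) (X r) = - m (X r) (X s)"
    if "1 \<le> r" "r \<le> p" "1 \<le> s" "s \<le> p" for r s
    using sym[of "X s" "X r"] that by (simp add: eq_neg_iff_add_eq_0)
  have sym_XY: "m (Y t) (X r) = - m (X r) (Y t)"
    if "1 \<le> r" "r \<le> p" "1 \<le> t" "t \<le> p" for r t
    using sym[of "Y t" "X r"] that by (simp add: eq_neg_iff_add_eq_0)
  have sym_YY: "m (Y t) (Y s) = m (Y s) (Y t)"
    if "1 \<le> s" "s \<le> p" "1 \<le> t" "t \<le> p" for s t
    using sym[of "Y t" "Y s"] that by simp
  have closed: "pullback_ad_X1 p (\<lambda>h. m h c) b = (-1) ^ (parity b * parity c) * pullback_ad_X1 p (\<lambda>h. m h b) c"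
    if "b \<in> gens p - {X 1}" "c \<in> gens p - {X 1}" for b c
    using m(2) that unfolding closed_matrix_def by blast
  \<comment> \<open>The minus sign comes from antisymmetry here and in the XY block, and from the
    parities in the YY block. The value 0 at \<open>j = p\<close> reflects that ad X_1 kills the
    last vector.\<close>
  have step_XX: "m (X (Suc i)) (X j) = (if j < p then - m (X i) (X (Suc j)) else 0)"
    if "2 \<le> i" "i < p" "2 \<le> j" "j \<le> p" for i j
    using closed[of "X i" "X j"] sym_XX[of i "Suc j"] that by auto
  have step_XY: "m (X (Suc i)) (Y j) = (if j < p then - m (X i) (Y (Suc j)) else 0)"
    if "2 \<le> i" "i < p" "1 \<le> j" "j \<le> p" for i j
    using closed[of "X i" "Y j"] sym_XY[of i "Suc j"] that by auto
  have step_YY: "m (Y (Suc i)) (Y j) = (if j < p then - m (Y i) (Y (Suc j)) else 0)"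
    if "1 \<le> i" "i < p" "1 \<le> j" "j \<le> p" for i j
    using closed[of "Y i" "Y j"] sym_YY[of i "Suc j"] that by auto
  have row_XX: "m (X 2) (X j) = 0" if j: "2 \<le> j" "j \<le> p" for j
  proof (cases "odd j")
    case True
    then obtain k where "j = 2 * k + 1" by (elim oddE)
    then have "(X 2, X j) \<in> index_set p"
      using j by (auto simp: index_set_def)
    then show ?thesis by (rule zero)
  next
    case False
    obtain k where k: "j = 2 + k"
      using j le_Suc_ex by blast
    \<comment> \<open>For even \<open>j\<close> the path to the transposed entry has an even number
      of steps, so the two entries agree; antisymmetry makes them opposite.\<close>
    have "m (X (2 + k)) (X 2) = (-1) ^ k * m (X 2) (X (2 + k))"
      by (rule grid_path[of 2 p 2 "\<lambda>i j. m (X i) (X j)"]) (use step_XX j k in auto)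
    then have "m (X j) (X 2) = m (X 2) (X j)"
      using False k by simp
    then show ?thesis
      using sym_XX[of 2 j] j p by (intro eq_neg_imp_0) simp
  qed
  have row_XY: "m (X 2) (Y j) = 0" if j: "1 \<le> j" "j \<le> p" for j
  proof (cases "j = p")
    case False
    then have "(X 2, Y j) \<in> index_set p"
      using j by (auto simp: index_set_def)
    then show ?thesis by (rule zero)
  next
    case True
    obtain k where k: "p = 2 + k"
      using p less_imp_add_positive by blast
    have "m (X (2 + k)) (Y 2) = (-1) ^ k * m (X 2) (Y (2 + k))"
      by (rule grid_path[of 2 p 1 "\<lambda>i j. m (X i) (Y j)"]) (use step_XY k in auto)
    \<comment> \<open>As ad X_1 kills X_p, closedness for X_p and Y_1 leaves only the entry at (Y_2,
      X_p), which must vanish; the path carries this to (X_2, Y_p).\<close>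
    moreover have "m (X p) (Y 2) = 0"
      using closed[of "X p" "Y 1"] sym_XY[of p 2] p by (auto simp: numeral_2_eq_2)
    ultimately show ?thesis
      using True k by simp
  qed
  have row_YY: "m (Y 1) (Y j) = 0" if j: "1 \<le> j" "j \<le> p" for j
  proof (cases "odd j")
    case True
    then obtain k where "j = 2 * k + 1" by (elim oddE)
    then have "(Y 1, Y j) \<in> index_set p"
      using j by (auto simp: index_set_def)
    then show ?thesis by (rule zero)
  next
    case False
    \<comment> \<open>For even \<open>j\<close> the number of steps is odd and the block symmetric,
      so the entry equals its own negative.\<close>
    have "m (Y (1 + (j - 1))) (Y 1) = (-1) ^ (j - 1) * m (Y 1) (Y (1 + (j - 1)))"
      by (rule grid_path[of 1 p 1 "\<lambda>i j. m (Y i) (Y j)"]) (use step_YY j in auto)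
    then have "m (Y j) (Y 1) = - m (Y 1) (Y j)"
      using False j by simp
    then show ?thesis
      using sym_YY[of 1 j] j p by (intro eq_neg_imp_0) simp
  qed
  have XX: "m (X i) (X j) = 0" if "2 \<le> i" "i \<le> p" "2 \<le> j" "j \<le> p" for i j
    by (rule grid_zero[of 2 p 2 "\<lambda>i j. m (X i) (X j)", OF step_XX row_XX that])
  have XY: "m (X i) (Y j) = 0" if "2 \<le> i" "i \<le> p" "1 \<le> j" "j \<le> p" for i j
    by (rule grid_zero[of 2 p 1 "\<lambda>i j. m (X i) (Y j)", OF step_XY row_XY that])
  have YY: "m (Y i) (Y j) = 0" if "1 \<le> i" "i \<le> p" "1 \<le> j" "j \<le> p" for i j
    by (rule grid_zero[of 1 p 1 "\<lambda>i j. m (Y i) (Y j)", OF step_YY row_YY that])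
  have ge_2: "2 \<le> i \<and> i \<le> p" if "X i \<in> gens p - {X 1}" for i
    using that by auto
  show ?thesis
  proof (cases a; cases b)
    fix i j assume "a = X i" "b = X j"
    then show ?thesis using ab ge_2 XX[of i j] by blast
  next
    fix i j assume "a = X i" "b = Y j"
    then show ?thesis using ab ge_2[of i] XY[of i j] by simp
  next
    fix i j assume "a = Y i" "b = X j"
    then show ?thesis using ab ge_2[of j] XY[of j i] sym_XY[of j i] by simp
  next
    fix i j assume "a = Y i" "b = Y j"
    then show ?thesis using ab YY[of i j] by simp
  qed
qed

lemma coordinates_eq_0_imp_coboundary:
  fixes lam :: "nat \<Rightarrow> 'a::field"
  assumes p: "odd p" "p > 2" and two: "(2 :: 'a) \<noteq> 0"
    and \<alpha>: "\<alpha> \<in> cocycles2 (model_filiform p lam)"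
    and zero: "\<And>q. q \<in> index_set p \<Longrightarrow> coordinate q \<alpha> = 0"
  shows "\<alpha> \<in> coboundaries2 (model_filiform p lam)"
proof -
  have p0: "p > 0" using p by simp
  obtain m where m: "\<alpha> = bilinear_cochain p m" "supersymmetric p m" "closed_matrix p m"
    using \<alpha> unfolding cocycles2_model_filiform[OF p0] by blast
  have m0: "m a b = 0" if "(a, b) \<in> index_set p" for a b
    using zero[OF that] index_set_subset[OF p] that by (auto simp: m(1) split: if_splits)
  have sym: "m a b + (-1) ^ (parity a * parity b) * m b a = 0" if "a \<in> gens p" "b \<in> gens p" for a b
    using m(2) that unfolding supersymmetric_def by blast
  have X1_X1: "m (X 1) (X 1) = 0"
    using sym[of "X 1" "X 1"] p two by (simp flip: mult_2)
  \<comment> \<open>The solution of - f([X_1, b]) = m(X_1, b), hence the index shift.\<close>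
  define f where "f = case_gen (\<lambda>j. - m (X 1) (X (j - 1))) (\<lambda>j. - m (X 1) (Y (j - 1)))"
  \<comment> \<open>At \<open>X p\<close> and \<open>Y p\<close> the left side is 0, and the right
    side is 0 by the two coordinates in the row of \<open>X 1\<close>.\<close>
  have pullback_f: "pullback_ad_X1 p f b = - m (X 1) b" if b: "b \<in> gens p" for b
    using b m0[of "X 1" "X p"] m0[of "X 1" "Y p"] X1_X1
    by (cases b) (auto simp: f_def index_set_def not_less dest: le_antisym)
  have "m a b = coboundary_matrix p f a b" if ab: "a \<in> gens p" "b \<in> gens p" for a b
  proof -
    consider "a = X 1" | "a \<noteq> X 1" "b = X 1" | "a \<noteq> X 1" "b \<noteq> X 1" by blast
    then show ?thesis
    proof cases
      case 1
      then show ?thesis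
        unfolding coboundary_matrix_def pullback_f[OF ab(2)] by simp
    next
      case 2
      then have "m a b = - m (X 1) a"
        using sym[OF ab] by (simp add: eq_neg_iff_add_eq_0)
      with 2 show ?thesis
        unfolding coboundary_matrix_def pullback_f[OF ab(1)] by simp
    next
      case 3
      then show ?thesis
        using matrix_eq_0_off_X1[OF p two m(2,3) m0, of a b] ab by (simp add: coboundary_matrix_def)
    qed
  qed
  then have "\<alpha> = bilinear_cochain p (coboundary_matrix p f)"
    unfolding m(1) by (rule bilinear_cochain_cong)
  then show ?thesis
    unfolding coboundaries2_model_filiform[OF p0] by blast
qed

text \<open>Closedness involves only entries off the row and column of \<open>X 1\<close>, where
  coboundary matrices vanish.\<close>

lemma coboundaries2_subset_cocycles2:
  assumes p: "p > 0"
  shows "coboundaries2 (model_filiform p lam) \<subseteq> cocycles2 (model_filiform p lam)"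
proof -
  have pullback_coboundary: "pullback_ad_X1 p (\<lambda>h. coboundary_matrix p f h c) b = 0" if "c \<noteq> X 1" for f :: "gen \<Rightarrow> 'a" and b c
    using that by (cases b) (auto simp: coboundary_matrix_def)
  have "supersymmetric p (coboundary_matrix p f)" "closed_matrix p (coboundary_matrix p f)" for f :: "gen \<Rightarrow> 'a"
    using pullback_coboundary
    by (auto simp: supersymmetric_def closed_matrix_def coboundary_matrix_def simp del: pullback_ad_X1.simps)
      (auto simp: coboundary_matrix_def)
  then show ?thesis
    unfolding coboundaries2_model_filiform[OF p] cocycles2_model_filiform[OF p] by blast
qed

text \<open>In the row of \<open>X 1\<close> only the columns \<open>X p\<close> and
  \<open>Y p\<close> are read off, and ad X_1 kills both vectors.\<close>

lemma coordinate_coboundary: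
  assumes p: "odd p" "p > 2" and \<alpha>: "\<alpha> \<in> coboundaries2 (model_filiform p lam)" and q: "q \<in> index_set p"
  shows "coordinate q \<alpha> = 0"
proof -
  have p0: "p > 0" using p by simp
  obtain f where \<alpha>: "\<alpha> = bilinear_cochain p (coboundary_matrix p f)"
    using \<alpha> unfolding coboundaries2_model_filiform[OF p0] by blast
  obtain a b where ab: "q = (a, b)" by (cases q)
  then have "a \<in> gens p" "b \<in> gens p"
    using index_set_subset[OF p] q by auto
  then have "coordinate q \<alpha> = (if a = Y 1 then -1 else 1) * coboundary_matrix p f a b"
    by (simp add: \<alpha> ab)
  also have "\<dots> = 0"
    using q by (auto simp: ab index_set_def coboundary_matrix_def)
  finally show ?thesis .
qed

section \<open>Dimension and basis of the second cohomology\<close>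

theorem theorem4p2:
  fixes lam :: "nat \<Rightarrow> 'a::alg_closed_field" and p :: nat
  assumes "CHAR('a) = p" and "p > 2"
  shows "vectorspace.dim class_ring (H2 (model_filiform p lam)) = 2 * p + 1
    \<and> Omega4 p \<subseteq> cocycles2 (model_filiform p lam)
    \<and> inj_on (cohomology_class (model_filiform p lam)) (Omega4 p)
    \<and> vectorspace.basis class_ring (H2 (model_filiform p lam))
        (cohomology_class (model_filiform p lam) ` Omega4 p)"
proof -
  let ?L = "model_filiform p lam" and ?I = "index_set p"
  let ?w = "index_cochain p :: gen \<times> gen \<Rightarrow> (gen \<Rightarrow> 'a) list \<Rightarrow> 'a"
  have p0: "p > 0" using assms by simp
  have odd: "odd p"
    using prime_CHAR_semidom[where 'a = 'a] assms prime_odd_nat by auto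
  have two: "(2 :: 'a) \<noteq> 0"
  proof
    assume "(2 :: 'a) = 0"
    then have "of_nat 2 = (0 :: 'a)" by simp
    then have "p dvd 2"
      unfolding of_nat_eq_0_iff_char_dvd assms(1) .
    with assms(2) show False
      using dvd_imp_le by fastforce
  qed
  have w: "?w q \<in> cocycles2 ?L" if "q \<in> ?I" for q
    using that supersymmetric_index_matrix[OF assms(2) that] closed_index_matrix[OF odd that]
    by (auto simp: cocycles2_model_filiform[OF p0] index_cochain_eq_bilinear_cochain[OF odd two])
  \<comment> \<open>The coboundaries are the common kernel of the coordinates, the form in which
    \<open>quotient_basis_of_dual_family\<close> takes the submodule.\<close>
  have N: "coboundaries2 ?L = {\<alpha> \<in> cocycles2 ?L. \<forall>q\<in>?I. coordinate q \<alpha> = 0}"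
    using coordinates_eq_0_imp_coboundary[OF odd assms(2) two] coordinate_coboundary[OF odd assms(2)]
      coboundaries2_subset_cocycles2[OF p0] by blast
  have add: "coordinate q (\<lambda>xs. \<alpha> xs + \<beta> xs) = coordinate q \<alpha> + (coordinate q \<beta> :: 'a)" for q \<alpha> \<beta>
    by (cases q) (simp add: distrib_left)
  have smult: "coordinate q (\<lambda>xs. c * \<alpha> xs) = c * (coordinate q \<alpha> :: 'a)" for q c \<alpha>
    by (cases q) simp
  note basis = quotient_basis_of_dual_family[OF vectorspace_cocycle_space[OF p0] finite_index_set,
      of "?w" p lam coordinate "coboundaries2 ?L", unfolded cocycle_space_simps]
  have "inj_on (cohomology_class ?L \<circ> ?w) ?I"
    "vectorspace.basis class_ring (H2 ?L) ((cohomology_class ?L \<circ> ?w) ` ?I)"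
    "vectorspace.dim class_ring (H2 ?L) = card ?I"
    unfolding comp_def cohomology_class_def H2_def
    by (rule basis; use w N add smult coordinate_index_cochain[OF odd assms(2) two] in blast)+
  then show ?thesis
    \<comment> \<open>Injectivity of the composite on \<open>index_set p\<close> passes to
      \<open>cohomology_class\<close> on the image, which is \<open>Omega4 p\<close>.\<close>
    using w card_index_set[OF odd assms(2)]
    by (auto simp: Omega4_eq_image_index_cochain[OF odd assms(2)] image_comp intro: inj_on_imageI)
qed

end
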